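(* Let $A$ be a commutative ring and $I$ an ideal of $A$. Let $r>1$ and $b_1,\dots,b_r\in A$, and suppose that the ideal $J=(b_1\cdots b_r)A+I$ of $A$ satisfies $b_iJ\subset I$ for each $i=1,\dots,r$. Then there is an isomorphism of groups $$K_2(A/I,J/I)\cong J/I\otimes_{A/I}\Omega_{A/I}.$$
   Context: For a commutative ring $S$, $\Omega_S=\Omega_{S/\mathbb{Z}}$ denotes the $S$-module of (absolute) Kähler differentials of $S$ over $\mathbb{Z}$. For a commutative ring $R$ and a radical ideal $\mathfrak{a}$ of $R$ (an ideal contained in the Jacobson radical, e.g. one with $\mathfrak{a}^2=0$), the relative group $K_2(R,\mathfrak{a})$ is the abelian group generated by the Dennis–Stein symbols $\langle a,b\rangle$ with $(a,b)\in(R\times\mathfrak{a})\cup(\mathfrak{a}\times R)$, subject to the relations (written multiplicatively, whenever all the symbols involved are defined): (DS1) $\langle a,b\rangle\langle b,a\rangle=1$; (DS2) $\langle a,b\rangle\langle a,c\rangle=\langle a,b+c-abc\rangle$; (DS3) $\langle a,bc\rangle=\langle ab,c\rangle\langle ac,b\rangle$ where at least one of $a,b,c$ lies in $\mathfrak{a}$. In the statement the ideal $J/I$ of $A/I$ satisfies $(J/I)^2=0$. *)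

theory Defs
  imports "HOL-Algebra.Algebra"
begin

definition presented_ab_group :: "'a set \<Rightarrow> ('a \<Rightarrow>\<^sub>0 int) set \<Rightarrow> ('a \<Rightarrow>\<^sub>0 int) set monoid"
  where "presented_ab_group S T =
    free_Abelian_group S Mod generate (free_Abelian_group S) T"

text \<open>The relative group \<open>K\<^sub>2(R, \<aa>)\<close>: the pair \<open>(a, b)\<close> stands for the Dennis--Stein symbol
  \<open>\<langle>a, b\<rangle>\<close>. Relations are written additively, since \<^const>\<open>free_Abelian_group\<close> is built on
  \<open>(+)\<close> of finitely supported functions. The definition is meant for radical ideals \<open>\<aa>\<close>.\<close>

definition DS_symbols :: "('a, 'm) ring_scheme \<Rightarrow> 'a set \<Rightarrow> ('a \<times> 'a) set"
  where "DS_symbols R \<aa> = carrier R \<times> \<aa> \<union> \<aa> \<times> carrier R"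

definition DS_relations :: "('a, 'm) ring_scheme \<Rightarrow> 'a set \<Rightarrow> ('a \<times> 'a \<Rightarrow>\<^sub>0 int) set"
  where "DS_relations R \<aa> =
    {frag_of (a, b) + frag_of (b, a) | a b. (a, b) \<in> DS_symbols R \<aa>} \<union>
    {frag_of (a, b) + frag_of (a, c) - frag_of (a, b \<oplus>\<^bsub>R\<^esub> c \<ominus>\<^bsub>R\<^esub> a \<otimes>\<^bsub>R\<^esub> b \<otimes>\<^bsub>R\<^esub> c) | a b c.
       (a, b) \<in> DS_symbols R \<aa> \<and> (a, c) \<in> DS_symbols R \<aa> \<and>
       (a, b \<oplus>\<^bsub>R\<^esub> c \<ominus>\<^bsub>R\<^esub> a \<otimes>\<^bsub>R\<^esub> b \<otimes>\<^bsub>R\<^esub> c) \<in> DS_symbols R \<aa>} \<union>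
    {frag_of (a, b \<otimes>\<^bsub>R\<^esub> c) - frag_of (a \<otimes>\<^bsub>R\<^esub> b, c) - frag_of (a \<otimes>\<^bsub>R\<^esub> c, b) | a b c.
       a \<in> carrier R \<and> b \<in> carrier R \<and> c \<in> carrier R \<and> (a \<in> \<aa> \<or> b \<in> \<aa> \<or> c \<in> \<aa>)}"

definition K2_rel :: "('a, 'm) ring_scheme \<Rightarrow> 'a set \<Rightarrow> ('a \<times> 'a \<Rightarrow>\<^sub>0 int) set monoid"
  where "K2_rel R \<aa> = presented_ab_group (DS_symbols R \<aa>) (DS_relations R \<aa>)"

text \<open>A \<^typ>\<open>('a, 'b) module\<close> record extends a ring record; the fields \<open>mult\<close> and \<open>one\<close> play no role
  for modules and are filled arbitrarily below.\<close>

definition ideal_module :: "('a, 'm) ring_scheme \<Rightarrow> 'a set \<Rightarrow> ('a, 'a) module"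
  where "ideal_module R \<aa> =
    \<lparr>carrier = \<aa>, monoid.mult = monoid.mult R, one = \<one>\<^bsub>R\<^esub>, ring.zero = \<zero>\<^bsub>R\<^esub>, ring.add = ring.add R,
     smult = monoid.mult R\<rparr>"

definition free_module :: "('a, 'm) ring_scheme \<Rightarrow> 's set \<Rightarrow> ('a, 's \<Rightarrow> 'a) module"
  where "free_module R S =
    \<lparr>carrier = {f \<in> S \<rightarrow>\<^sub>E carrier R. finite {s \<in> S. f s \<noteq> \<zero>\<^bsub>R\<^esub>}},
     monoid.mult = undefined, one = undefined,
     ring.zero = (\<lambda>s\<in>S. \<zero>\<^bsub>R\<^esub>), ring.add = (\<lambda>f g. \<lambda>s\<in>S. f s \<oplus>\<^bsub>R\<^esub> g s),
     smult = (\<lambda>a f. \<lambda>s\<in>S. a \<otimes>\<^bsub>R\<^esub> f s)\<rparr>"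

definition free_basis :: "('a, 'm) ring_scheme \<Rightarrow> 's set \<Rightarrow> 's \<Rightarrow> 's \<Rightarrow> 'a"
  where "free_basis R S s = (\<lambda>t\<in>S. if t = s then \<one>\<^bsub>R\<^esub> else \<zero>\<^bsub>R\<^esub>)"

definition module_span ::
    "('a, 'm) ring_scheme \<Rightarrow> ('a, 'b, 'n) module_scheme \<Rightarrow> 'b set \<Rightarrow> 'b set"
  where "module_span R M T = \<Inter>{N. submodule N R M \<and> T \<subseteq> N}"

definition quotient_module :: "('a, 'b, 'n) module_scheme \<Rightarrow> 'b set \<Rightarrow> ('a, 'b set) module"
  where "quotient_module M N =
    \<lparr>carrier = a_rcosets\<^bsub>M\<^esub> N, monoid.mult = undefined, one = undefined,
     ring.zero = N, ring.add = set_add M, smult = (\<lambda>a C. \<Union>x\<in>C. N +>\<^bsub>M\<^esub> (a \<odot>\<^bsub>M\<^esub> x))\<rparr>"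

text \<open>The absolute Kaehler differentials \<open>\<Omega>\<^bsub>R/\<int>\<^esub>\<close>: generators \<open>d x\<close> for \<open>x\<close> in \<open>R\<close>, with
  additivity and the Leibniz rule. The usual third family \<open>d (n \<cdot> 1) = 0\<close> for integers \<open>n\<close>
  follows from these: Leibniz gives \<open>d 1 = 0\<close>.\<close>

definition Kaehler_relations :: "('a, 'm) ring_scheme \<Rightarrow> ('a \<Rightarrow> 'a) set"
  where "Kaehler_relations R =
    (let F = free_module R (carrier R); d = free_basis R (carrier R) in
      {d (x \<oplus>\<^bsub>R\<^esub> y) \<ominus>\<^bsub>F\<^esub> (d x \<oplus>\<^bsub>F\<^esub> d y) | x y. x \<in> carrier R \<and> y \<in> carrier R} \<union>
      {d (x \<otimes>\<^bsub>R\<^esub> y) \<ominus>\<^bsub>F\<^esub> (x \<odot>\<^bsub>F\<^esub> d y \<oplus>\<^bsub>F\<^esub> y \<odot>\<^bsub>F\<^esub> d x) | x y.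
         x \<in> carrier R \<and> y \<in> carrier R})"

definition Kaehler :: "('a, 'm) ring_scheme \<Rightarrow> ('a, ('a \<Rightarrow> 'a) set) module"
  where "Kaehler R =
    (let F = free_module R (carrier R) in quotient_module F (module_span R F (Kaehler_relations R)))"

text \<open>The abelian group underlying \<open>M \<otimes>\<^sub>R N\<close>; the pair \<open>(x, y)\<close> stands for \<open>x \<otimes> y\<close>.\<close>

definition tensor_relations :: "('a, 'm) ring_scheme \<Rightarrow> ('a, 'b, 'n) module_scheme \<Rightarrow>
    ('a, 'c, 'p) module_scheme \<Rightarrow> ('b \<times> 'c \<Rightarrow>\<^sub>0 int) set"
  where "tensor_relations R M N =
    {frag_of (x \<oplus>\<^bsub>M\<^esub> x', y) - frag_of (x, y) - frag_of (x', y) | x x' y.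
       x \<in> carrier M \<and> x' \<in> carrier M \<and> y \<in> carrier N} \<union>
    {frag_of (x, y \<oplus>\<^bsub>N\<^esub> y') - frag_of (x, y) - frag_of (x, y') | x y y'.
       x \<in> carrier M \<and> y \<in> carrier N \<and> y' \<in> carrier N} \<union>
    {frag_of (a \<odot>\<^bsub>M\<^esub> x, y) - frag_of (x, a \<odot>\<^bsub>N\<^esub> y) | a x y.
       a \<in> carrier R \<and> x \<in> carrier M \<and> y \<in> carrier N}"

definition tensor_group :: "('a, 'm) ring_scheme \<Rightarrow> ('a, 'b, 'n) module_scheme \<Rightarrow>
    ('a, 'c, 'p) module_scheme \<Rightarrow> ('b \<times> 'c \<Rightarrow>\<^sub>0 int) set monoid"
  where "tensor_group R M N =
    presented_ab_group (carrier M \<times> carrier N) (tensor_relations R M N)"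

text \<open>The ideal \<open>J/I\<close> of \<open>A/I\<close>.\<close>

definition quotient_ideal :: "('a, 'm) ring_scheme \<Rightarrow> 'a set \<Rightarrow> 'a set \<Rightarrow> 'a set set"
  where "quotient_ideal A J I = (\<lambda>x. I +>\<^bsub>A\<^esub> x) ` J"

end

theory Submission
  imports Defs
begin

text \<open>
  Write \<open>R = A/I\<close> and \<open>\<aa> = J/I\<close>. The isomorphism sends \<open>\<langle>a, b\<rangle>\<close> to \<open>a \<otimes> d b\<close> if \<open>a \<in> \<aa>\<close>, and to
  \<open>- b \<otimes> d a\<close> if \<open>b \<in> \<aa>\<close>. The inverse sends \<open>a \<otimes> c d s\<close> to \<open>\<langle>a c, s\<rangle>\<close>.

  What could go wrong is visible in (DS2), \<open>\<langle>a, b\<rangle> + \<langle>a, c\<rangle> = \<langle>a, b + c - a b c\<rangle>\<close>: the symbol is additive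
  in its second entry only if the correction term \<open>a b c \<in> \<aa>\<close> does not matter, and \<open>\<phi>\<close> respects the
  relation only if \<open>a \<otimes> d (a b c) = 0\<close>. So one needs \<open>\<langle>a, a'\<rangle> = 0\<close> and \<open>a \<otimes> d a' = 0\<close> for all
  \<open>a, a' \<in> \<aa>\<close>; the second also makes the two formulas for \<open>\<phi>\<close> agree where both apply. For a general
  square-zero ideal neither need hold. Here every element of \<open>\<aa>\<close> is a product \<open>y z\<close> of two elements
  that annihilate \<open>\<aa>\<close>, because \<open>b\<^sub>1 \<cdots> b\<^sub>r\<close> has at least two factors. Then (DS3) and the Leibniz rule
  yield both vanishing statements: lemmas \<open>symbol_ideal\<close> and \<open>tensor_d_ideal\<close>.

  After this, the relations (DS1), (DS2), (DS3) turn into bilinearity and the Leibniz rule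
  (\<open>\<phi>_relation\<close>), and conversely the symbols \<open>\<langle>a, s\<rangle>\<close> with \<open>a \<in> \<aa>\<close> are biadditive and satisfy the
  Leibniz rule in \<open>s\<close>, so that the inverse is well defined on the tensor product with the
  differentials (\<open>\<Psi>_cong\<close>, \<open>\<psi>_relation\<close>). That the maps are inverse to each other is checked on
  generators.
\<close>

section \<open>Abelian groups given by generators and relations\<close>

text \<open>Working with the congruence \<open>u - v \<in> null\<close> on finitely supported functions, instead of with
  cosets, keeps computations in a presented group inside the type class of abelian groups.\<close>

locale presentation =
  fixes S :: "'a set" and T :: "('a \<Rightarrow>\<^sub>0 int) set"
  assumes keys_relation: "t \<in> T \<Longrightarrow> Poly_Mapping.keys t \<subseteq> S"
begin

definition null :: "('a \<Rightarrow>\<^sub>0 int) set"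
  where "null = generate (free_Abelian_group S) T"

definition eqv :: "('a \<Rightarrow>\<^sub>0 int) \<Rightarrow> ('a \<Rightarrow>\<^sub>0 int) \<Rightarrow> bool"  (infix \<open>\<bumpeq>\<close> 50)
  where "u \<bumpeq> v \<longleftrightarrow> u - v \<in> null"

sublocale group "free_Abelian_group S"
  by simp

lemma null_subgroup: "subgroup null (free_Abelian_group S)"
  unfolding null_def by (rule generate_is_subgroup) (use keys_relation in auto)

lemma keys_null: "u \<in> null \<Longrightarrow> Poly_Mapping.keys u \<subseteq> S"
  using subgroup.mem_carrier[OF null_subgroup, of u] by simp

lemma null_zero: "0 \<in> null"
  using subgroup.one_closed[OF null_subgroup] by simp

lemma null_add: "u \<in> null \<Longrightarrow> v \<in> null \<Longrightarrow> u + v \<in> null"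
  using subgroup.m_closed[OF null_subgroup] by simp

lemma null_minus: "u \<in> null \<Longrightarrow> - u \<in> null"
  using subgroup.m_inv_closed[OF null_subgroup, of u] keys_null[of u] by simp

lemma null_relation: "t \<in> T \<Longrightarrow> t \<in> null"
  unfolding null_def by (rule generate.incl)

lemma eqv_refl [simp]: "u \<bumpeq> u"
  by (simp add: eqv_def null_zero)

lemma eqv_sym: "u \<bumpeq> v \<Longrightarrow> v \<bumpeq> u"
  unfolding eqv_def by (drule null_minus) simp

lemma eqv_trans [trans]: "u \<bumpeq> v \<Longrightarrow> v \<bumpeq> w \<Longrightarrow> u \<bumpeq> w"
  unfolding eqv_def by (drule (1) null_add) simp

lemma eqv_add: "u \<bumpeq> u' \<Longrightarrow> v \<bumpeq> v' \<Longrightarrow> u + v \<bumpeq> u' + v'"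
  unfolding eqv_def by (drule (1) null_add) (simp add: algebra_simps)

lemma eqv_minus: "u \<bumpeq> u' \<Longrightarrow> - u \<bumpeq> - u'"
  unfolding eqv_def by (drule null_minus) (simp add: algebra_simps)

lemma eqv_diff: "u \<bumpeq> u' \<Longrightarrow> v \<bumpeq> v' \<Longrightarrow> u - v \<bumpeq> u' - v'"
  using eqv_add[OF _ eqv_minus, of u u' v v'] by simp

lemma eqv_sum: "(\<And>k. k \<in> K \<Longrightarrow> p k \<bumpeq> q k) \<Longrightarrow> (\<Sum>k\<in>K. p k) \<bumpeq> (\<Sum>k\<in>K. q k)"
  by (induction K rule: infinite_finite_induct) (auto intro: eqv_add)

lemma eqv_iff_diff: "u \<bumpeq> v \<longleftrightarrow> u - v \<bumpeq> 0"
  by (simp add: eqv_def)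

lemma null_iff: "u \<in> null \<longleftrightarrow> u \<bumpeq> 0"
  by (simp add: eqv_def)

lemma eqv_relation: "u - v \<in> T \<Longrightarrow> u \<bumpeq> v"
  by (simp add: eqv_def null_relation)

lemma eqv_zero_if_double: "u \<bumpeq> u + u \<Longrightarrow> u \<bumpeq> 0"
  unfolding eqv_def by (drule null_minus) simp

lemma coset_eq_iff:
  assumes "Poly_Mapping.keys u \<subseteq> S" "Poly_Mapping.keys v \<subseteq> S"
  shows "null #>\<^bsub>free_Abelian_group S\<^esub> u = null #>\<^bsub>free_Abelian_group S\<^esub> v \<longleftrightarrow> u \<bumpeq> v"
proof
  assume "null #>\<^bsub>free_Abelian_group S\<^esub> u = null #>\<^bsub>free_Abelian_group S\<^esub> v"
  then have "u \<in> null #>\<^bsub>free_Abelian_group S\<^esub> v"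
    using rcos_self[OF _ null_subgroup, of u] assms by simp
  then show "u \<bumpeq> v"
    by (auto simp: r_coset_def eqv_def)
next
  assume "u \<bumpeq> v"
  then have "u \<in> null #>\<^bsub>free_Abelian_group S\<^esub> v"
    unfolding r_coset_def eqv_def by (auto intro!: bexI[of _ "u - v"])
  then show "null #>\<^bsub>free_Abelian_group S\<^esub> u = null #>\<^bsub>free_Abelian_group S\<^esub> v"
    using repr_independence[OF _ _ null_subgroup, of u v] assms by simp
qed

lemma null_normal: "null \<lhd> free_Abelian_group S"
  by (rule comm_group.subgroup_imp_normal[OF abelian_free_Abelian_group null_subgroup])

lemma presented_ab_group_eq: "presented_ab_group S T = free_Abelian_group S Mod null"
  by (simp add: presented_ab_group_def null_def)

end

lemma keys_frag_extend_subset: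
  assumes "Poly_Mapping.keys u \<subseteq> S" "\<And>s. s \<in> S \<Longrightarrow> Poly_Mapping.keys (f s) \<subseteq> S'"
  shows "Poly_Mapping.keys (frag_extend f u) \<subseteq> S'"
  using keys_frag_extend[of f u] assms by blast

lemma frag_extend_eqv:
  assumes "presentation S T" "presentation S' T'"
    and rel: "\<And>t. t \<in> T \<Longrightarrow> presentation.eqv S' T' (frag_extend f t) 0"
    and "presentation.eqv S T u v"
  shows "presentation.eqv S' T' (frag_extend f u) (frag_extend f v)"
proof -
  interpret P: presentation S T by fact
  interpret Q: presentation S' T' by fact
  have "Q.eqv (frag_extend f w) 0" if "w \<in> generate (free_Abelian_group S) T" for w
    using that
  proof induction
    case (inv h)
    then have "inv\<^bsub>free_Abelian_group S\<^esub> h = - h"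
      using P.keys_relation by simp
    then show ?case
      using Q.eqv_minus[OF rel[OF inv]] by (simp add: frag_extend_minus)
  next
    case (eng u v)
    then show ?case
      using Q.eqv_add[OF eng.IH] by (simp add: frag_extend_add)
  qed (auto simp: rel)
  then have "Q.eqv (frag_extend f (u - v)) 0"
    using assms(4) by (simp add: P.eqv_def P.null_def)
  then show ?thesis
    by (simp add: frag_extend_diff flip: Q.eqv_iff_diff)
qed

lemma frag_extend_inverse:
  assumes "presentation S T"
    and "\<And>s. s \<in> S \<Longrightarrow> presentation.eqv S T (frag_extend g (f s)) (frag_of s)"
    and "Poly_Mapping.keys u \<subseteq> S"
  shows "presentation.eqv S T (frag_extend g (frag_extend f u)) u"
proof -
  interpret P: presentation S T by fact
  show ?thesis
    by (rule free_Abelian_group_induct[OF assms(3)])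
      (simp_all add: frag_extend_diff P.eqv_diff assms(2))
qed

text \<open>Congruences are easier to handle than homomorphisms between quotient groups: two families
  of images of the generators that respect the relations and are inverse to each other on
  generators, both up to the relations, already give an isomorphism.\<close>

lemma presented_ab_group_iso:
  assumes P: "presentation S T" and Q: "presentation S' T'"
    and f: "\<And>s. s \<in> S \<Longrightarrow> Poly_Mapping.keys (f s) \<subseteq> S'"
    and g: "\<And>s. s \<in> S' \<Longrightarrow> Poly_Mapping.keys (g s) \<subseteq> S"
    and f_rel: "\<And>t. t \<in> T \<Longrightarrow> presentation.eqv S' T' (frag_extend f t) 0"
    and g_rel: "\<And>t. t \<in> T' \<Longrightarrow> presentation.eqv S T (frag_extend g t) 0"
    and gf: "\<And>s. s \<in> S \<Longrightarrow> presentation.eqv S T (frag_extend g (f s)) (frag_of s)"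
    and fg: "\<And>s. s \<in> S' \<Longrightarrow> presentation.eqv S' T' (frag_extend f (g s)) (frag_of s)"
  shows "presented_ab_group S T \<cong> presented_ab_group S' T'"
proof -
  interpret P: presentation S T by fact
  interpret Q: presentation S' T' by fact
  let ?F = "free_Abelian_group S" and ?Q = "free_Abelian_group S' Mod Q.null"
  \<comment> \<open>It suffices to see that \<open>h\<close> below is onto with kernel \<open>P.null\<close>, by the first isomorphism theorem.\<close>
  define h where "h = (\<lambda>u. Q.null #>\<^bsub>free_Abelian_group S'\<^esub> frag_extend f u)"
  have keys_f: "Poly_Mapping.keys (frag_extend f u) \<subseteq> S'" if "Poly_Mapping.keys u \<subseteq> S" for u
    using that f by (rule keys_frag_extend_subset)
  have keys_g: "Poly_Mapping.keys (frag_extend g u) \<subseteq> S" if "Poly_Mapping.keys u \<subseteq> S'" for u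
    using that g by (rule keys_frag_extend_subset)
  interpret NQ: normal Q.null "free_Abelian_group S'"
    by (rule Q.null_normal)
  have "h \<in> hom ?F ?Q"
  proof (rule homI)
    fix u assume "u \<in> carrier ?F"
    then have "frag_extend f u \<in> carrier (free_Abelian_group S')"
      using keys_f by simp
    then show "h u \<in> carrier ?Q"
      unfolding h_def carrier_FactGroup by (rule imageI)
  next
    fix u v assume "u \<in> carrier ?F" "v \<in> carrier ?F"
    then show "h (u \<otimes>\<^bsub>?F\<^esub> v) = h u \<otimes>\<^bsub>?Q\<^esub> h v"
      using keys_f by (simp add: h_def FactGroup_def NQ.rcos_sum frag_extend_add)
  qed
  then interpret h: group_hom ?F ?Q h
    by (intro group_hom.intro group_hom_axioms.intro NQ.factorgroup_is_group) simp_all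
  have "kernel ?F ?Q h = P.null"
  proof (intro equalityI subsetI)
    fix u assume "u \<in> kernel ?F ?Q h"
    then have u: "Poly_Mapping.keys u \<subseteq> S" and "h u = Q.null"
      by (auto simp: kernel_def FactGroup_def)
    then have "Q.eqv (frag_extend f u) 0"
      using Q.coset_eq_iff[of "frag_extend f u" 0] keys_f[OF u] Q.coset_mult_one[OF NQ.subset]
      by (simp add: h_def)
    then have "P.eqv (frag_extend g (frag_extend f u)) 0"
      using frag_extend_eqv[OF Q P g_rel] by fastforce
    then show "u \<in> P.null"
      using P.eqv_trans[OF P.eqv_sym[OF frag_extend_inverse[OF P gf u]]]
      by (simp add: P.null_iff)
  next
    fix u assume u: "u \<in> P.null"
    then have "Q.eqv (frag_extend f u) 0"
      using frag_extend_eqv[OF P Q f_rel, of u 0] by (simp add: P.null_iff)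
    then show "u \<in> kernel ?F ?Q h"
      using Q.coset_eq_iff[of "frag_extend f u" 0] P.keys_null[OF u] keys_f
        Q.coset_mult_one[OF NQ.subset]
      by (simp add: kernel_def h_def FactGroup_def)
  qed
  moreover have "h ` carrier ?F = carrier ?Q"
  proof
    show "carrier ?Q \<subseteq> h ` carrier ?F"
    proof
      fix C assume "C \<in> carrier ?Q"
      then obtain v where v: "Poly_Mapping.keys v \<subseteq> S'"
        and C: "C = Q.null #>\<^bsub>free_Abelian_group S'\<^esub> v"
        by (auto simp: carrier_FactGroup)
      have "h (frag_extend g v) = C"
        unfolding C h_def
        using Q.coset_eq_iff[OF keys_f[OF keys_g[OF v]] v] frag_extend_inverse[OF Q fg v] by simp
      then show "C \<in> h ` carrier ?F"
        using keys_g[OF v] by (simp add: rev_image_eqI)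
    qed
  qed (use h.hom_closed in blast)
  ultimately show ?thesis
    using h.FactGroup_iso by (simp add: P.presented_ab_group_eq Q.presented_ab_group_eq)
qed

section \<open>Quotient modules and free modules\<close>

context module
begin

lemma submoduleI_smult:
  assumes "H \<subseteq> carrier M" "\<zero>\<^bsub>M\<^esub> \<in> H" "\<And>x y. x \<in> H \<Longrightarrow> y \<in> H \<Longrightarrow> x \<oplus>\<^bsub>M\<^esub> y \<in> H"
    and smult: "\<And>a x. a \<in> carrier R \<Longrightarrow> x \<in> H \<Longrightarrow> a \<odot>\<^bsub>M\<^esub> x \<in> H"
  shows "submodule H R M"
proof (rule submoduleI)
  fix x assume "x \<in> H"
  then show "\<ominus>\<^bsub>M\<^esub> x \<in> H"
    using smult[of "\<ominus> \<one>" x] assms(1) by (auto simp: smult_l_minus subset_iff)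
qed (fact assms)+

lemma submodule_Inter:
  assumes sub: "\<And>N. N \<in> \<N> \<Longrightarrow> submodule N R M" and "\<N> \<noteq> {}"
  shows "submodule (\<Inter>\<N>) R M"
proof -
  have "\<zero>\<^bsub>M\<^esub> \<in> N" if "N \<in> \<N>" for N
    using subgroup.one_closed[OF submodule.axioms(1)[OF sub[OF that]]] by simp
  moreover have "\<Inter>\<N> \<subseteq> carrier M"
    using submoduleE(1)[OF sub] assms(2) by blast
  ultimately show ?thesis
    using submoduleE(3-5)[OF sub] by (intro submoduleI) auto
qed

lemma module_span_submodule:
  assumes "T \<subseteq> carrier M"
  shows "submodule (module_span R M T) R M"
  unfolding module_span_def using assms carrier_is_submodule by (intro submodule_Inter) auto

lemma module_span_least: "submodule N R M \<Longrightarrow> T \<subseteq> N \<Longrightarrow> module_span R M T \<subseteq> N"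
  by (auto simp: module_span_def)

lemma subset_module_span: "T \<subseteq> module_span R M T"
  by (auto simp: module_span_def)

lemma submodule_abelian_subgroup: "submodule N R M \<Longrightarrow> abelian_subgroup N M"
  by (intro abelian_subgroupI3 additive_subgroup.intro submodule.axioms(1)) (auto intro: M.abelian_group_axioms)

end

locale module_with_submodule = module R M for R (structure) and M (structure) +
  fixes N
  assumes submodule: "submodule N R M"
begin

sublocale N: abelian_subgroup N M
  by (rule submodule_abelian_subgroup[OF submodule])

abbreviation Q where "Q \<equiv> quotient_module M N"

lemma carrier_quotient_module: "carrier Q = (\<lambda>x. N +>\<^bsub>M\<^esub> x) ` carrier M"
  by (auto simp: quotient_module_def A_RCOSETS_def')

lemma quotient_closed: "x \<in> carrier M \<Longrightarrow> N +>\<^bsub>M\<^esub> x \<in> carrier Q"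
  by (simp add: carrier_quotient_module)

lemma coset_eq_iff:
  assumes "x \<in> carrier M" "y \<in> carrier M"
  shows "N +>\<^bsub>M\<^esub> x = N +>\<^bsub>M\<^esub> y \<longleftrightarrow> x \<ominus>\<^bsub>M\<^esub> y \<in> N"
  using assms N.a_rcos_module[of y x] N.a_repr_independence'[of x y] N.a_repr_independenceD[of x y]
  by (metis a_minus_def)

lemma quotient_add:
  assumes "x \<in> carrier M" "y \<in> carrier M"
  shows "(N +>\<^bsub>M\<^esub> x) \<oplus>\<^bsub>Q\<^esub> (N +>\<^bsub>M\<^esub> y) = N +>\<^bsub>M\<^esub> (x \<oplus>\<^bsub>M\<^esub> y)"
  using assms by (simp add: quotient_module_def N.a_rcos_sum)

text \<open>Scalar multiplication of a coset is a union over its members; it is a single coset because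
  two members differ by an element of \<open>N\<close> and \<open>N\<close> is stable under scalars.\<close>

lemma quotient_smult:
  assumes "a \<in> carrier R" "x \<in> carrier M"
  shows "a \<odot>\<^bsub>Q\<^esub> (N +>\<^bsub>M\<^esub> x) = N +>\<^bsub>M\<^esub> (a \<odot>\<^bsub>M\<^esub> x)"
proof -
  have const: "N +>\<^bsub>M\<^esub> (a \<odot>\<^bsub>M\<^esub> y) = N +>\<^bsub>M\<^esub> (a \<odot>\<^bsub>M\<^esub> x)" if y: "y \<in> N +>\<^bsub>M\<^esub> x" for y
  proof -
    have carr: "y \<in> carrier M"
      using N.a_elemrcos_carrier assms y by blast
    have "y \<ominus>\<^bsub>M\<^esub> x \<in> N"
      using y assms carr N.a_rcos_module[of x y] by (simp add: a_minus_def)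
    then have "a \<odot>\<^bsub>M\<^esub> (y \<ominus>\<^bsub>M\<^esub> x) \<in> N"
      using submoduleE(4)[OF submodule] assms by blast
    then show ?thesis
      using assms carr by (simp add: coset_eq_iff a_minus_def smult_r_distr smult_r_minus)
  qed
  have "N +>\<^bsub>M\<^esub> x \<noteq> {}"
    using N.a_rcos_self[OF assms(2)] by (metis empty_iff)
  then have "(\<Union>y\<in>N +>\<^bsub>M\<^esub> x. N +>\<^bsub>M\<^esub> (a \<odot>\<^bsub>M\<^esub> y)) = N +>\<^bsub>M\<^esub> (a \<odot>\<^bsub>M\<^esub> x)"
    using const by (rule SUP_eq_const)
  then show ?thesis
    by (simp add: quotient_module_def)
qed

lemma quotient_zero: "\<zero>\<^bsub>Q\<^esub> = N +>\<^bsub>M\<^esub> \<zero>\<^bsub>M\<^esub>"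
  using N.a_rcos_const[OF N.zero_closed] by (simp add: quotient_module_def)

lemma quotient_module_is_module: "module R Q"
proof (rule moduleI)
  show "abelian_group Q"
  proof (rule abelian_groupI)
    fix C assume "C \<in> carrier Q"
    then obtain x where "x \<in> carrier M" and C: "C = N +>\<^bsub>M\<^esub> x"
      by (auto simp: carrier_quotient_module)
    then show "\<exists>D\<in>carrier Q. D \<oplus>\<^bsub>Q\<^esub> C = \<zero>\<^bsub>Q\<^esub>"
      by (intro bexI[of _ "N +>\<^bsub>M\<^esub> (\<ominus>\<^bsub>M\<^esub> x)"])
        (simp_all add: quotient_add quotient_closed quotient_zero M.l_neg)
  qed (auto simp: carrier_quotient_module quotient_add quotient_zero M.a_ac)
qed (auto simp: carrier_quotient_module quotient_add quotient_smult smult_l_distr smult_r_distr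
      smult_assoc1 cring_axioms)

end

context cring
begin

lemma free_module_simps:
  "carrier (free_module R S) = {f \<in> S \<rightarrow>\<^sub>E carrier R. finite {s \<in> S. f s \<noteq> \<zero>}}"
  "\<zero>\<^bsub>free_module R S\<^esub> = (\<lambda>s\<in>S. \<zero>)"
  "f \<oplus>\<^bsub>free_module R S\<^esub> g = (\<lambda>s\<in>S. f s \<oplus> g s)"
  "a \<odot>\<^bsub>free_module R S\<^esub> f = (\<lambda>s\<in>S. a \<otimes> f s)"
  by (simp_all add: free_module_def)

lemma free_module_is_module:
  fixes S :: "'s set"
  shows "module R (free_module R S)"
proof (rule moduleI)
  let ?F = "free_module R S"
  have fin_add: "finite {s \<in> S. f s \<oplus> g s \<noteq> \<zero>}"
    if "finite {s \<in> S. f s \<noteq> \<zero>}" "finite {s \<in> S. g s \<noteq> \<zero>}" for f g :: "'s \<Rightarrow> 'a"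
    by (rule finite_subset[OF _ finite_UnI[OF that]]) auto
  have fin_smult: "finite {s \<in> S. a \<otimes> f s \<noteq> \<zero>}"
    if "finite {s \<in> S. f s \<noteq> \<zero>}" "a \<in> carrier R" for a and f :: "'s \<Rightarrow> 'a"
    by (rule finite_subset[OF _ that(1)]) (use that in auto)
  show smult_closed: "a \<odot>\<^bsub>?F\<^esub> f \<in> carrier ?F"
    if "a \<in> carrier R" "f \<in> carrier ?F" for a f
    using that by (auto simp: free_module_simps PiE_iff intro!: fin_smult cong: conj_cong)
  show "abelian_group ?F"
  proof (rule abelian_groupI)
    fix f assume f: "f \<in> carrier ?F"
    have "(\<ominus> \<one>) \<odot>\<^bsub>?F\<^esub> f \<oplus>\<^bsub>?F\<^esub> f = \<zero>\<^bsub>?F\<^esub>"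
      using f by (auto simp: free_module_simps PiE_iff l_minus l_neg)
    then show "\<exists>g\<in>carrier ?F. g \<oplus>\<^bsub>?F\<^esub> f = \<zero>\<^bsub>?F\<^esub>"
      using smult_closed f by blast
  qed (auto simp: free_module_simps PiE_iff fun_eq_iff extensional_def a_ac cong: conj_cong
        intro!: fin_add)
qed (auto simp: free_module_simps PiE_iff fun_eq_iff extensional_def cring_axioms l_distr r_distr m_assoc)

lemma free_basis_closed: "s \<in> S \<Longrightarrow> free_basis R S s \<in> carrier (free_module R S)"
  by (auto simp: free_module_simps free_basis_def intro: finite_subset[of _ "{s}"])

text \<open>By induction on the support: splitting off one coordinate from an element of the free
  module leaves an element with smaller support.\<close>

lemma free_module_eq_submodule:
  assumes N: "submodule N R (free_module R S)"
    and basis: "\<And>s. s \<in> S \<Longrightarrow> free_basis R S s \<in> N"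
    and f: "f \<in> carrier (free_module R S)"
  shows "f \<in> N"
proof -
  let ?F = "free_module R S"
  interpret F: module R ?F
    by (rule free_module_is_module)
  have "f \<in> N" if "finite B" "B \<subseteq> S" "f \<in> S \<rightarrow>\<^sub>E carrier R" "{s \<in> S. f s \<noteq> \<zero>} \<subseteq> B" for B f
    using that
  proof (induction B arbitrary: f rule: finite_induct)
    case empty
    then have "f = \<zero>\<^bsub>?F\<^esub>"
      by (auto simp: free_module_simps PiE_iff extensional_def fun_eq_iff)
    then show ?case
      using subgroup.one_closed[OF submodule.axioms(1)[OF N]] by simp
  next
    case (insert s B)
    define g where "g = (\<lambda>t\<in>S. if t = s then \<zero> else f t)"
    have "g \<in> N"
      using insert.prems by (intro insert.IH) (auto simp: g_def)
    moreover have "f s \<odot>\<^bsub>?F\<^esub> free_basis R S s \<in> N"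
      using insert.prems by (intro F.submoduleE(4)[OF N] basis) auto
    moreover have "f = f s \<odot>\<^bsub>?F\<^esub> free_basis R S s \<oplus>\<^bsub>?F\<^esub> g"
      using insert.prems
      by (auto simp: free_module_simps g_def free_basis_def PiE_iff extensional_def fun_eq_iff)
    ultimately show ?case
      using F.submoduleE(5)[OF N] by metis
  qed
  from this[of "{s \<in> S. f s \<noteq> \<zero>}" f] show ?thesis
    using f by (auto simp: free_module_simps)
qed

end

section \<open>Kaehler differentials\<close>

locale kaehler_differentials = cring R for R :: "('a, 'm) ring_scheme" (structure)
begin

abbreviation "F \<equiv> free_module R (carrier R)"
abbreviation "N \<equiv> module_span R F (Kaehler_relations R)"
abbreviation "\<Omega> \<equiv> Kaehler R"

definition d :: "'a \<Rightarrow> ('a \<Rightarrow> 'a) set"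
  where "d x = N +>\<^bsub>F\<^esub> free_basis R (carrier R) x"

sublocale F: module R F
  by (rule free_module_is_module)

lemma Kaehler_relations_closed: "Kaehler_relations R \<subseteq> carrier F"
  by (auto simp: Kaehler_relations_def Let_def free_basis_closed)

sublocale F: module_with_submodule R F N
  by (rule module_with_submodule.intro[OF F.module_axioms module_with_submodule_axioms.intro])
    (rule F.module_span_submodule[OF Kaehler_relations_closed])

lemma Kaehler_eq: "\<Omega> = quotient_module F N"
  by (simp add: Kaehler_def Let_def)

sublocale \<Omega>: module R \<Omega>
  unfolding Kaehler_eq by (rule F.quotient_module_is_module)

lemma d_closed [simp]: "x \<in> carrier R \<Longrightarrow> d x \<in> carrier \<Omega>"
  by (simp add: d_def Kaehler_eq free_basis_closed F.quotient_closed)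

lemma d_add:
  assumes "x \<in> carrier R" "y \<in> carrier R"
  shows "d (x \<oplus> y) = d x \<oplus>\<^bsub>\<Omega>\<^esub> d y"
proof -
  let ?e = "free_basis R (carrier R)"
  have "?e (x \<oplus> y) \<ominus>\<^bsub>F\<^esub> (?e x \<oplus>\<^bsub>F\<^esub> ?e y) \<in> N"
    using assms
    by (intro subsetD[OF F.subset_module_span]) (auto simp: Kaehler_relations_def Let_def)
  then show ?thesis
    using assms by (simp add: d_def Kaehler_eq F.quotient_add F.coset_eq_iff free_basis_closed)
qed

lemma d_mult:
  assumes "x \<in> carrier R" "y \<in> carrier R"
  shows "d (x \<otimes> y) = x \<odot>\<^bsub>\<Omega>\<^esub> d y \<oplus>\<^bsub>\<Omega>\<^esub> y \<odot>\<^bsub>\<Omega>\<^esub> d x"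
proof -
  let ?e = "free_basis R (carrier R)"
  have "?e (x \<otimes> y) \<ominus>\<^bsub>F\<^esub> (x \<odot>\<^bsub>F\<^esub> ?e y \<oplus>\<^bsub>F\<^esub> y \<odot>\<^bsub>F\<^esub> ?e x) \<in> N"
    using assms
    by (intro subsetD[OF F.subset_module_span]) (auto simp: Kaehler_relations_def Let_def)
  then show ?thesis
    using assms by (simp add: d_def Kaehler_eq F.quotient_add F.quotient_smult F.coset_eq_iff free_basis_closed)
qed

end

section \<open>Ideals whose elements are products of two annihilating factors\<close>

lemma ideal_module_simps [simp]:
  "carrier (ideal_module R \<aa>) = \<aa>"
  "x \<oplus>\<^bsub>ideal_module R \<aa>\<^esub> y = x \<oplus>\<^bsub>R\<^esub> y"
  "a \<odot>\<^bsub>ideal_module R \<aa>\<^esub> x = a \<otimes>\<^bsub>R\<^esub> x"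
  by (simp_all add: ideal_module_def)

text \<open>This hypothesis isolates what makes all symbols with two entries in \<open>\<aa>\<close> trivial, on both sides:
  if \<open>b = y z\<close> with \<open>y\<close> and \<open>z\<close> annihilating \<open>\<aa>\<close>, then (DS3) gives
  \<open>\<langle>a, y z\<rangle> = \<langle>a y, z\<rangle> + \<langle>a z, y\<rangle> = 0\<close>, and the Leibniz rule gives
  \<open>a \<otimes> d (y z) = a y \<otimes> d z + a z \<otimes> d y = 0\<close>. It also forces \<open>\<aa>\<^sup>2 = 0\<close>. A principal ideal
  \<open>(y z)\<close> with \<open>y \<aa> = z \<aa> = 0\<close> is an example.\<close>

locale factored_annihilated_ideal = kaehler_differentials R + ideal \<aa> R
  for R :: "('a, 'm) ring_scheme" (structure) and \<aa> +
  assumes annihilating_factors: "b \<in> \<aa> \<Longrightarrow> \<exists>y\<in>carrier R. \<exists>z\<in>carrier R. b = y \<otimes> z \<and>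
    (\<forall>a\<in>\<aa>. y \<otimes> a = \<zero>) \<and> (\<forall>a\<in>\<aa>. z \<otimes> a = \<zero>)"
begin

lemma in_carrier [simp]: "a \<in> \<aa> \<Longrightarrow> a \<in> carrier R"
  by (rule a_Hcarr)

lemma square_zero:
  assumes "a \<in> \<aa>" "b \<in> \<aa>"
  shows "a \<otimes> b = \<zero>"
proof -
  obtain y z where "y \<in> carrier R" "z \<in> carrier R" "a = y \<otimes> z" "z \<otimes> b = \<zero>"
    using annihilating_factors[OF assms(1)] assms(2) by metis
  then show ?thesis
    using assms by (simp add: m_assoc)
qed

subsection \<open>The tensor product\<close>

abbreviation "tensor_gens \<equiv> \<aa> \<times> carrier \<Omega>"
abbreviation "tensor_rels \<equiv> tensor_relations R (ideal_module R \<aa>) \<Omega>"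

lemma presentation_tensor: "presentation tensor_gens tensor_rels"
proof
  fix t assume "t \<in> tensor_rels"
  then show "Poly_Mapping.keys t \<subseteq> tensor_gens"
    unfolding tensor_relations_def
    by (elim UnE CollectE exE conjE; simp; intro order.trans[OF keys_diff] Un_least)
      (auto simp: keys_frag_of I_l_closed)
qed

sublocale T: presentation tensor_gens tensor_rels
  by (rule presentation_tensor)

lemma tensor_add_left:
  assumes "a \<in> \<aa>" "a' \<in> \<aa>" "w \<in> carrier \<Omega>"
  shows "T.eqv (frag_of (a \<oplus> a', w)) (frag_of (a, w) + frag_of (a', w))"
proof -
  have "frag_of (a \<oplus> a', w) - frag_of (a, w) - frag_of (a', w) \<in> tensor_rels"
    unfolding tensor_relations_def ideal_module_simps using assms by blast
  then show ?thesis
    by (intro T.eqv_relation) (simp add: diff_diff_eq)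
qed

lemma tensor_add_right:
  assumes "a \<in> \<aa>" "w \<in> carrier \<Omega>" "w' \<in> carrier \<Omega>"
  shows "T.eqv (frag_of (a, w \<oplus>\<^bsub>\<Omega>\<^esub> w')) (frag_of (a, w) + frag_of (a, w'))"
proof -
  have "frag_of (a, w \<oplus>\<^bsub>\<Omega>\<^esub> w') - frag_of (a, w) - frag_of (a, w') \<in> tensor_rels"
    unfolding tensor_relations_def ideal_module_simps using assms by blast
  then show ?thesis
    by (intro T.eqv_relation) (simp add: diff_diff_eq)
qed

lemma tensor_smult:
  assumes "c \<in> carrier R" "a \<in> \<aa>" "w \<in> carrier \<Omega>"
  shows "T.eqv (frag_of (c \<otimes> a, w)) (frag_of (a, c \<odot>\<^bsub>\<Omega>\<^esub> w))"
proof -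
  have "frag_of (c \<otimes> a, w) - frag_of (a, c \<odot>\<^bsub>\<Omega>\<^esub> w) \<in> tensor_rels"
    unfolding tensor_relations_def ideal_module_simps using assms by blast
  then show ?thesis
    by (rule T.eqv_relation)
qed

lemma tensor_zero_left:
  assumes "w \<in> carrier \<Omega>"
  shows "T.eqv (frag_of (\<zero>, w)) 0"
  using tensor_add_left[of \<zero> \<zero> w] assms by (intro T.eqv_zero_if_double) simp

lemma tensor_zero_right:
  assumes "a \<in> \<aa>"
  shows "T.eqv (frag_of (a, \<zero>\<^bsub>\<Omega>\<^esub>)) 0"
  using tensor_add_right[of a "\<zero>\<^bsub>\<Omega>\<^esub>" "\<zero>\<^bsub>\<Omega>\<^esub>"] assms by (intro T.eqv_zero_if_double) simp

lemma tensor_d_add: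
  assumes "a \<in> \<aa>" "b \<in> carrier R" "c \<in> carrier R"
  shows "T.eqv (frag_of (a, d (b \<oplus> c))) (frag_of (a, d b) + frag_of (a, d c))"
  using assms by (simp add: d_add tensor_add_right)

lemma tensor_d_mult:
  assumes "a \<in> \<aa>" "b \<in> carrier R" "c \<in> carrier R"
  shows "T.eqv (frag_of (a, d (b \<otimes> c))) (frag_of (b \<otimes> a, d c) + frag_of (c \<otimes> a, d b))"
proof -
  have "T.eqv (frag_of (a, d (b \<otimes> c)))
      (frag_of (a, b \<odot>\<^bsub>\<Omega>\<^esub> d c) + frag_of (a, c \<odot>\<^bsub>\<Omega>\<^esub> d b))"
    using assms by (simp add: d_mult tensor_add_right)
  also have "T.eqv \<dots> (frag_of (b \<otimes> a, d c) + frag_of (c \<otimes> a, d b))"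
    using assms by (intro T.eqv_add T.eqv_sym[OF tensor_smult]) simp_all
  finally show ?thesis .
qed

lemma tensor_d_ideal:
  assumes "a \<in> \<aa>" "b \<in> \<aa>"
  shows "T.eqv (frag_of (a, d b)) 0"
proof -
  obtain y z where yz: "y \<in> carrier R" "z \<in> carrier R" "b = y \<otimes> z" "y \<otimes> a = \<zero>" "z \<otimes> a = \<zero>"
    using annihilating_factors[OF assms(2)] assms(1) by metis
  then have "T.eqv (frag_of (a, d b)) (frag_of (\<zero>, d z) + frag_of (\<zero>, d y))"
    using tensor_d_mult[OF assms(1), of y z] by simp
  also have "T.eqv \<dots> (0 + 0)"
    using yz by (intro T.eqv_add tensor_zero_left) simp_all
  finally show ?thesis by simp
qed

subsection \<open>From the relative group to the tensor product\<close>

text \<open>The two cases overlap when both entries lie in \<open>\<aa>\<close>, and then both candidate values vanish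
  in the tensor product; so the choice made here is harmless, which is lemma \<open>\<phi>_right\<close>.\<close>

definition \<phi> :: "'a \<times> 'a \<Rightarrow> 'a \<times> ('a \<Rightarrow> 'a) set \<Rightarrow>\<^sub>0 int"
  where "\<phi> = (\<lambda>(a, b). if a \<in> \<aa> then frag_of (a, d b) else - frag_of (b, d a))"

lemma \<phi>_left: "a \<in> \<aa> \<Longrightarrow> \<phi> (a, b) = frag_of (a, d b)"
  by (simp add: \<phi>_def)

lemma \<phi>_right:
  assumes "b \<in> \<aa>"
  shows "T.eqv (\<phi> (a, b)) (- frag_of (b, d a))"
proof (cases "a \<in> \<aa>")
  case True
  have "T.eqv (frag_of (a, d b)) 0"
    using True assms by (rule tensor_d_ideal)
  moreover have "T.eqv 0 (- frag_of (b, d a))"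
    using T.eqv_sym[OF T.eqv_minus[OF tensor_d_ideal[OF assms True]]] by simp
  ultimately show ?thesis
    using True by (simp add: \<phi>_left T.eqv_trans)
qed (simp add: \<phi>_def)

lemma DS_symbols_cases:
  assumes "(a, b) \<in> DS_symbols R \<aa>"
  obtains (left) "a \<in> \<aa>" "b \<in> carrier R" | (right) "a \<in> carrier R" "b \<in> \<aa>"
  using assms by (auto simp: DS_symbols_def)

lemma keys_\<phi>:
  assumes "(a, b) \<in> DS_symbols R \<aa>"
  shows "Poly_Mapping.keys (\<phi> (a, b)) \<subseteq> tensor_gens"
  using assms by (auto simp: \<phi>_def DS_symbols_def keys_frag_of)

lemma \<phi>_skew:
  assumes "(a, b) \<in> DS_symbols R \<aa>"
  shows "T.eqv (\<phi> (a, b) + \<phi> (b, a)) 0"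
  using assms
proof (cases rule: DS_symbols_cases)
  case left
  then show ?thesis
    using T.eqv_add[OF T.eqv_refl \<phi>_right[OF left(1), of b], of "\<phi> (a, b)"] by (simp add: \<phi>_left)
next
  case right
  then show ?thesis
    using T.eqv_add[OF \<phi>_right[OF right(2), of a] T.eqv_refl, of "\<phi> (b, a)"] by (simp add: \<phi>_left)
qed

text \<open>If \<open>a \<in> \<aa>\<close>, the correction term \<open>a b c\<close> of (DS2) lies in \<open>\<aa>\<close>, so \<open>a \<otimes> d (a b c)\<close> vanishes.
  Otherwise \<open>b\<close> and \<open>c\<close> lie in \<open>\<aa>\<close>, the correction term is zero, and the relation is additivity
  of the tensor product in its first argument.\<close>

lemma \<phi>_add:
  assumes "(a, b) \<in> DS_symbols R \<aa>" "(a, c) \<in> DS_symbols R \<aa>"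
  shows "T.eqv (\<phi> (a, b) + \<phi> (a, c)) (\<phi> (a, b \<oplus> c \<ominus> a \<otimes> b \<otimes> c))"
proof (cases "a \<in> \<aa>")
  case True
  have carr: "b \<in> carrier R" "c \<in> carrier R"
    using assms by (auto simp: DS_symbols_def)
  have abc: "a \<otimes> b \<otimes> c \<in> \<aa>"
    using True carr by (simp add: I_r_closed)
  have "b \<oplus> c = (b \<oplus> c \<ominus> a \<otimes> b \<otimes> c) \<oplus> a \<otimes> b \<otimes> c"
    using carr True by (simp add: a_minus_def a_assoc l_neg)
  then have "T.eqv (frag_of (a, d (b \<oplus> c)))
      (frag_of (a, d (b \<oplus> c \<ominus> a \<otimes> b \<otimes> c)) + frag_of (a, d (a \<otimes> b \<otimes> c)))"
    using tensor_d_add[OF True, of "b \<oplus> c \<ominus> a \<otimes> b \<otimes> c" "a \<otimes> b \<otimes> c"] carr True by simp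
  also have "T.eqv \<dots> (frag_of (a, d (b \<oplus> c \<ominus> a \<otimes> b \<otimes> c)) + 0)"
    by (intro T.eqv_add T.eqv_refl tensor_d_ideal True abc)
  finally show ?thesis
    using T.eqv_trans[OF T.eqv_sym[OF tensor_d_add[OF True carr]]] True by (simp add: \<phi>_left)
next
  case False
  then have *: "a \<in> carrier R" "b \<in> \<aa>" "c \<in> \<aa>"
    using assms by (auto simp: DS_symbols_def)
  then have eq: "b \<oplus> c \<ominus> a \<otimes> b \<otimes> c = b \<oplus> c"
    by (simp add: m_assoc square_zero a_minus_def)
  have "T.eqv (- frag_of (b, d a) + - frag_of (c, d a)) (- frag_of (b \<oplus> c, d a))"
    using T.eqv_minus[OF T.eqv_sym[OF tensor_add_left[of b c "d a"]]] * by simp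
  then show ?thesis
    using False by (simp add: \<phi>_def eq)
qed

text \<open>For \<open>a \<in> \<aa>\<close> this is the Leibniz rule for \<open>d (b c)\<close>. If only \<open>b\<close> or only \<open>c\<close> is known to lie in
  \<open>\<aa>\<close>, it is the Leibniz rule for \<open>d (a c)\<close> or \<open>d (a b)\<close>, with one summand moved to the other side.\<close>

lemma \<phi>_mult:
  assumes "a \<in> carrier R" "b \<in> carrier R" "c \<in> carrier R" "a \<in> \<aa> \<or> b \<in> \<aa> \<or> c \<in> \<aa>"
  shows "T.eqv (\<phi> (a, b \<otimes> c)) (\<phi> (a \<otimes> b, c) + \<phi> (a \<otimes> c, b))"
proof -
  have ideal_case: "T.eqv (\<phi> (x, y \<otimes> z)) (\<phi> (x \<otimes> y, z) + \<phi> (x \<otimes> z, y))"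
    if "x \<in> carrier R" "y \<in> \<aa>" "z \<in> carrier R" for x y z
  proof -
    have xyz: "x \<otimes> y \<in> \<aa>" "y \<otimes> z \<in> \<aa>"
      using that by (simp_all add: I_l_closed I_r_closed)
    have "T.eqv (\<phi> (x \<otimes> y, z) + \<phi> (x \<otimes> z, y)) (frag_of (x \<otimes> y, d z) + - frag_of (y, d (x \<otimes> z)))"
      using that xyz by (intro T.eqv_add \<phi>_right) (simp_all add: \<phi>_left)
    also have "T.eqv \<dots> (frag_of (x \<otimes> y, d z) + - (frag_of (x \<otimes> y, d z) + frag_of (z \<otimes> y, d x)))"
      using that by (intro T.eqv_add T.eqv_refl T.eqv_minus tensor_d_mult)
    also have "\<dots> = - frag_of (y \<otimes> z, d x)"
      using that by (simp add: m_comm)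
    finally show ?thesis
      by (rule T.eqv_trans[OF \<phi>_right[OF xyz(2)] T.eqv_sym])
  qed
  consider "a \<in> \<aa>" | "b \<in> \<aa>" | "c \<in> \<aa>"
    using assms by blast
  then show ?thesis
  proof cases
    case 1
    then show ?thesis
      using tensor_d_mult[of a b c] assms
      by (simp add: \<phi>_left I_r_closed m_comm add.commute)
  next
    case 2
    then show ?thesis
      using ideal_case assms by blast
  next
    case 3
    then show ?thesis
      using ideal_case[of a c b] assms by (simp add: m_comm add.commute)
  qed
qed

lemma \<phi>_relation:
  assumes "t \<in> DS_relations R \<aa>"
  shows "T.eqv (frag_extend \<phi> t) 0"
proof -
  consider
      a b where "t = frag_of (a, b) + frag_of (b, a)" "(a, b) \<in> DS_symbols R \<aa>"
    | a b c where "t = frag_of (a, b) + frag_of (a, c) - frag_of (a, b \<oplus> c \<ominus> a \<otimes> b \<otimes> c)"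
        "(a, b) \<in> DS_symbols R \<aa>" "(a, c) \<in> DS_symbols R \<aa>"
    | a b c where "t = frag_of (a, b \<otimes> c) - frag_of (a \<otimes> b, c) - frag_of (a \<otimes> c, b)"
        "a \<in> carrier R" "b \<in> carrier R" "c \<in> carrier R" "a \<in> \<aa> \<or> b \<in> \<aa> \<or> c \<in> \<aa>"
    using assms unfolding DS_relations_def by blast
  then show ?thesis
  proof cases
    case 1
    then show ?thesis
      by (simp add: frag_extend_add \<phi>_skew)
  next
    case 2
    then show ?thesis
      using \<phi>_add[OF 2(2,3)]
      by (simp add: frag_extend_add frag_extend_diff flip: T.eqv_iff_diff)
  next
    case 3
    then show ?thesis
      using \<phi>_mult[OF 3(2-5)]
      by (simp add: frag_extend_diff frag_extend_add diff_diff_eq flip: T.eqv_iff_diff)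
  qed
qed

subsection \<open>Bilinearity of Dennis--Stein symbols\<close>

lemma presentation_K2: "presentation (DS_symbols R \<aa>) (DS_relations R \<aa>)"
proof
  fix t assume "t \<in> DS_relations R \<aa>"
  then show "Poly_Mapping.keys t \<subseteq> DS_symbols R \<aa>"
    unfolding DS_relations_def
    by (elim UnE CollectE exE conjE; simp;
        intro order.trans[OF keys_diff] order.trans[OF keys_add] Un_least)
      (auto simp: keys_frag_of DS_symbols_def I_l_closed I_r_closed)
qed

sublocale K: presentation "DS_symbols R \<aa>" "DS_relations R \<aa>"
  by (rule presentation_K2)

lemma symbol_skew:
  assumes "(a, b) \<in> DS_symbols R \<aa>"
  shows "K.eqv (frag_of (a, b)) (- frag_of (b, a))"
proof -
  have "frag_of (a, b) + frag_of (b, a) \<in> DS_relations R \<aa>"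
    using assms unfolding DS_relations_def by blast
  then show ?thesis
    by (intro K.eqv_relation) simp
qed

lemma symbol_add:
  assumes "(a, b) \<in> DS_symbols R \<aa>" "(a, c) \<in> DS_symbols R \<aa>"
    "(a, b \<oplus> c \<ominus> a \<otimes> b \<otimes> c) \<in> DS_symbols R \<aa>"
  shows "K.eqv (frag_of (a, b \<oplus> c \<ominus> a \<otimes> b \<otimes> c)) (frag_of (a, b) + frag_of (a, c))"
proof -
  have "frag_of (a, b) + frag_of (a, c) - frag_of (a, b \<oplus> c \<ominus> a \<otimes> b \<otimes> c) \<in> DS_relations R \<aa>"
    using assms unfolding DS_relations_def by blast
  then show ?thesis
    by (intro K.eqv_sym[OF K.eqv_relation])
qed

lemma symbol_mult_right:
  assumes "a \<in> \<aa>" "b \<in> carrier R" "c \<in> carrier R"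
  shows "K.eqv (frag_of (a, b \<otimes> c)) (frag_of (a \<otimes> b, c) + frag_of (a \<otimes> c, b))"
proof -
  have "frag_of (a, b \<otimes> c) - frag_of (a \<otimes> b, c) - frag_of (a \<otimes> c, b) \<in> DS_relations R \<aa>"
    using assms in_carrier[OF assms(1)] unfolding DS_relations_def by blast
  then show ?thesis
    by (intro K.eqv_relation) (simp add: diff_diff_eq)
qed

text \<open>By skew-symmetry this is (DS2) for \<open>\<langle>b, a\<rangle>\<close> and \<open>\<langle>b, a'\<rangle>\<close>, whose correction term \<open>b a a'\<close> is
  zero because \<open>\<aa>\<^sup>2 = 0\<close>.\<close>

lemma symbol_add_left:
  assumes "a \<in> \<aa>" "a' \<in> \<aa>" "b \<in> carrier R"
  shows "K.eqv (frag_of (a \<oplus> a', b)) (frag_of (a, b) + frag_of (a', b))"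
proof -
  have eq: "a \<oplus> a' \<ominus> b \<otimes> a \<otimes> a' = a \<oplus> a'"
    using assms by (simp add: m_assoc square_zero a_minus_def)
  have *: "K.eqv (frag_of (b, a \<oplus> a')) (frag_of (b, a) + frag_of (b, a'))"
    using symbol_add[of b a a'] assms unfolding eq by (simp add: DS_symbols_def)
  have "K.eqv (frag_of (a \<oplus> a', b)) (- frag_of (b, a \<oplus> a'))"
    using assms by (intro symbol_skew) (simp add: DS_symbols_def)
  also have "K.eqv \<dots> (- (frag_of (b, a) + frag_of (b, a')))"
    using * by (rule K.eqv_minus)
  also have "\<dots> = - frag_of (b, a) + - frag_of (b, a')"
    by simp
  also have "K.eqv \<dots> (frag_of (a, b) + frag_of (a', b))"
    using assms by (intro K.eqv_add K.eqv_sym[OF symbol_skew]) (simp_all add: DS_symbols_def)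
  finally show ?thesis .
qed

lemma symbol_zero_left:
  assumes "b \<in> carrier R"
  shows "K.eqv (frag_of (\<zero>, b)) 0"
  using symbol_add_left[of \<zero> \<zero> b] assms by (intro K.eqv_zero_if_double) simp

lemma symbol_ideal:
  assumes "a \<in> \<aa>" "b \<in> \<aa>"
  shows "K.eqv (frag_of (a, b)) 0"
proof -
  obtain y z where yz: "y \<in> carrier R" "z \<in> carrier R" "b = y \<otimes> z" "y \<otimes> a = \<zero>" "z \<otimes> a = \<zero>"
    using annihilating_factors[OF assms(2)] assms(1) by metis
  then have "a \<otimes> y = \<zero>" "a \<otimes> z = \<zero>"
    using assms by (simp_all add: m_comm)
  then have "K.eqv (frag_of (a, b)) (frag_of (\<zero>, z) + frag_of (\<zero>, y))"
    using symbol_mult_right[OF assms(1) yz(1,2)] yz by simp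
  also have "K.eqv \<dots> (0 + 0)"
    using yz by (intro K.eqv_add symbol_zero_left)
  finally show ?thesis by simp
qed

text \<open>Here the correction term \<open>p = a b c\<close> of (DS2) need not vanish, but it lies in \<open>\<aa>\<close>. Applying
  (DS2) a second time, to \<open>e = b + c - p\<close> and \<open>p\<close>, restores \<open>b + c\<close>, since \<open>a e p = 0\<close>, and it
  costs only the symbol \<open>\<langle>a, p\<rangle>\<close>, which is trivial.\<close>

lemma symbol_add_right:
  assumes "a \<in> \<aa>" "b \<in> carrier R" "c \<in> carrier R"
  shows "K.eqv (frag_of (a, b \<oplus> c)) (frag_of (a, b) + frag_of (a, c))"
proof -
  let ?e = "b \<oplus> c \<ominus> a \<otimes> b \<otimes> c" and ?p = "a \<otimes> b \<otimes> c"
  have carr: "a \<in> carrier R" "?p \<in> \<aa>"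
    using assms by (simp_all add: I_r_closed)
  then have "a \<otimes> ?p = \<zero>"
    using assms by (simp add: square_zero)
  then have "a \<otimes> ?e \<otimes> ?p = \<zero>"
    using carr assms m_lcomm[of a ?e ?p] m_assoc[of a ?e ?p] by simp
  then have "?e \<oplus> ?p \<ominus> a \<otimes> ?e \<otimes> ?p = b \<oplus> c"
    using carr assms by (simp add: a_minus_def a_assoc l_neg)
  then have "K.eqv (frag_of (a, b \<oplus> c)) (frag_of (a, ?e) + frag_of (a, ?p))"
    using symbol_add[of a ?e ?p] assms carr by (simp add: DS_symbols_def)
  also have "K.eqv \<dots> ((frag_of (a, b) + frag_of (a, c)) + 0)"
    using assms carr by (intro K.eqv_add symbol_add symbol_ideal) (simp_all add: DS_symbols_def)
  finally show ?thesis by simp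
qed

end

context factored_annihilated_ideal
begin

subsection \<open>From the tensor product to the relative group\<close>

text \<open>The value of the inverse map on \<open>a \<otimes> (\<Sum>\<^sub>s f(s) d s)\<close>, before passing from the free module to
  the differentials.\<close>

definition \<Psi> :: "'a \<Rightarrow> ('a \<Rightarrow> 'a) \<Rightarrow> 'a \<times> 'a \<Rightarrow>\<^sub>0 int"
  where "\<Psi> a f = (\<Sum>s\<in>{s \<in> carrier R. f s \<noteq> \<zero>}. frag_of (a \<otimes> f s, s))"

lemma F_apply [simp]: "f \<in> carrier F \<Longrightarrow> s \<in> carrier R \<Longrightarrow> f s \<in> carrier R"
  by (auto simp: free_module_simps)

lemma finite_support: "f \<in> carrier F \<Longrightarrow> finite {s \<in> carrier R. f s \<noteq> \<zero>}"
  by (simp add: free_module_simps)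

text \<open>Enlarging the index set only adds trivial symbols \<open>\<langle>0, s\<rangle>\<close>, so sums over different supports can
  be compared on a common index set. The possibility \<open>1 = 0\<close> in \<open>R\<close>, where basis vectors have empty
  support, is covered as well.\<close>

lemma \<Psi>_superset:
  assumes "a \<in> \<aa>" "finite B" "{s \<in> carrier R. f s \<noteq> \<zero>} \<subseteq> B" "B \<subseteq> carrier R"
  shows "K.eqv (\<Psi> a f) (\<Sum>s\<in>B. frag_of (a \<otimes> f s, s))"
proof -
  let ?S = "{s \<in> carrier R. f s \<noteq> \<zero>}"
  have "K.eqv (frag_of (a \<otimes> f s, s)) 0" if "s \<in> B - ?S" for s
  proof -
    have "s \<in> carrier R" "f s = \<zero>"
      using that assms(4) by auto
    then show ?thesis
      using symbol_zero_left assms(1) by simp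
  qed
  then have "K.eqv (\<Sum>s\<in>B - ?S. frag_of (a \<otimes> f s, s)) (\<Sum>s\<in>B - ?S. 0)"
    by (rule K.eqv_sum)
  then have "K.eqv (\<Psi> a f + (\<Sum>s\<in>B - ?S. frag_of (a \<otimes> f s, s))) (\<Psi> a f + 0)"
    by (intro K.eqv_add K.eqv_refl) simp
  moreover have "(\<Sum>s\<in>B. frag_of (a \<otimes> f s, s)) = \<Psi> a f + (\<Sum>s\<in>B - ?S. frag_of (a \<otimes> f s, s))"
    unfolding \<Psi>_def using sum.subset_diff[OF assms(3,2)] by (simp add: add.commute)
  ultimately show ?thesis
    by (intro K.eqv_sym[where v = "\<Psi> a f"]) simp
qed

lemma \<Psi>_basis:
  assumes "a \<in> \<aa>" "b \<in> carrier R"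
  shows "K.eqv (\<Psi> a (free_basis R (carrier R) b)) (frag_of (a, b))"
proof -
  let ?e = "free_basis R (carrier R) b"
  have "{s \<in> carrier R. ?e s \<noteq> \<zero>} \<subseteq> {b}"
    by (auto simp: free_basis_def)
  then show ?thesis
    using \<Psi>_superset[OF assms(1), of "{b}" ?e] assms by (simp add: free_basis_def)
qed

lemma \<Psi>_add_left:
  assumes "a \<in> \<aa>" "a' \<in> \<aa>" "f \<in> carrier F"
  shows "K.eqv (\<Psi> (a \<oplus> a') f) (\<Psi> a f + \<Psi> a' f)"
proof -
  have "K.eqv (frag_of ((a \<oplus> a') \<otimes> f s, s)) (frag_of (a \<otimes> f s, s) + frag_of (a' \<otimes> f s, s))"
    if "s \<in> {s \<in> carrier R. f s \<noteq> \<zero>}" for s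
    using that assms by (simp add: l_distr symbol_add_left I_r_closed)
  then show ?thesis
    unfolding \<Psi>_def sum.distrib[symmetric] by (rule K.eqv_sum)
qed

lemma \<Psi>_add_right:
  assumes "a \<in> \<aa>" "f \<in> carrier F" "g \<in> carrier F"
  shows "K.eqv (\<Psi> a (f \<oplus>\<^bsub>F\<^esub> g)) (\<Psi> a f + \<Psi> a g)"
proof -
  let ?B = "{s \<in> carrier R. f s \<noteq> \<zero>} \<union> {s \<in> carrier R. g s \<noteq> \<zero>}"
  have B: "finite ?B" "?B \<subseteq> carrier R"
    using assms by (auto simp: finite_support)
  have "{s \<in> carrier R. (f \<oplus>\<^bsub>F\<^esub> g) s \<noteq> \<zero>} \<subseteq> ?B"
    by (auto simp: free_module_simps)
  then have "K.eqv (\<Psi> a (f \<oplus>\<^bsub>F\<^esub> g)) (\<Sum>s\<in>?B. frag_of (a \<otimes> (f \<oplus>\<^bsub>F\<^esub> g) s, s))"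
    by (intro \<Psi>_superset assms B)
  also have "K.eqv \<dots> (\<Sum>s\<in>?B. frag_of (a \<otimes> f s, s) + frag_of (a \<otimes> g s, s))"
  proof (rule K.eqv_sum)
    fix s assume "s \<in> ?B"
    then have "s \<in> carrier R"
      using B by blast
    then show "K.eqv (frag_of (a \<otimes> (f \<oplus>\<^bsub>F\<^esub> g) s, s)) (frag_of (a \<otimes> f s, s) + frag_of (a \<otimes> g s, s))"
      using assms symbol_add_left[of "a \<otimes> f s" "a \<otimes> g s" s]
      by (simp add: free_module_simps(3) r_distr I_r_closed)
  qed
  also have "\<dots> = (\<Sum>s\<in>?B. frag_of (a \<otimes> f s, s)) + (\<Sum>s\<in>?B. frag_of (a \<otimes> g s, s))"
    by (rule sum.distrib)
  also have "K.eqv \<dots> (\<Psi> a f + \<Psi> a g)"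
    by (intro K.eqv_add K.eqv_sym[OF \<Psi>_superset] assms B) simp_all
  finally show ?thesis .
qed

lemma \<Psi>_smult:
  assumes "a \<in> \<aa>" "c \<in> carrier R" "f \<in> carrier F"
  shows "K.eqv (\<Psi> (c \<otimes> a) f) (\<Psi> a (c \<odot>\<^bsub>F\<^esub> f))"
proof -
  let ?S = "{s \<in> carrier R. f s \<noteq> \<zero>}"
  have "K.eqv (\<Psi> a (c \<odot>\<^bsub>F\<^esub> f)) (\<Sum>s\<in>?S. frag_of (a \<otimes> (c \<odot>\<^bsub>F\<^esub> f) s, s))"
    using assms by (intro \<Psi>_superset finite_support) (auto simp: free_module_simps(4))
  also have "\<dots> = \<Psi> (c \<otimes> a) f"
    unfolding \<Psi>_def using assms by (intro sum.cong) (simp_all add: free_module_simps(4) m_ac)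
  finally show ?thesis
    by (rule K.eqv_sym)
qed

lemma \<Psi>_zero: "\<Psi> a \<zero>\<^bsub>F\<^esub> = 0"
  unfolding \<Psi>_def by (rule sum.neutral) (auto simp: free_module_simps)

lemma \<Psi>_diff:
  assumes "a \<in> \<aa>" "f \<in> carrier F" "g \<in> carrier F"
  shows "K.eqv (\<Psi> a (f \<ominus>\<^bsub>F\<^esub> g)) (\<Psi> a f - \<Psi> a g)"
proof -
  have "f = (f \<ominus>\<^bsub>F\<^esub> g) \<oplus>\<^bsub>F\<^esub> g"
    using assms by (simp add: a_minus_def F.M.a_assoc F.M.l_neg)
  then have "K.eqv (\<Psi> a f) (\<Psi> a (f \<ominus>\<^bsub>F\<^esub> g) + \<Psi> a g)"
    using \<Psi>_add_right[OF assms(1), of "f \<ominus>\<^bsub>F\<^esub> g" g] assms by simp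
  then have "K.eqv (\<Psi> a f - \<Psi> a g) (\<Psi> a (f \<ominus>\<^bsub>F\<^esub> g) + \<Psi> a g - \<Psi> a g)"
    by (intro K.eqv_diff K.eqv_refl)
  then show ?thesis
    by (intro K.eqv_sym[where v = "\<Psi> a (f \<ominus>\<^bsub>F\<^esub> g)"]) simp
qed

text \<open>The additivity relations go to additivity of \<open>\<langle>a, -\<rangle>\<close>, and the Leibniz relations to (DS3).\<close>

lemma \<Psi>_Kaehler_relation:
  assumes "a \<in> \<aa>" "f \<in> Kaehler_relations R"
  shows "K.eqv (\<Psi> a f) 0"
proof -
  let ?e = "free_basis R (carrier R)"
  consider
      x y where "f = ?e (x \<oplus> y) \<ominus>\<^bsub>F\<^esub> (?e x \<oplus>\<^bsub>F\<^esub> ?e y)" "x \<in> carrier R" "y \<in> carrier R"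
    | x y where "f = ?e (x \<otimes> y) \<ominus>\<^bsub>F\<^esub> (x \<odot>\<^bsub>F\<^esub> ?e y \<oplus>\<^bsub>F\<^esub> y \<odot>\<^bsub>F\<^esub> ?e x)" "x \<in> carrier R" "y \<in> carrier R"
    using assms(2) unfolding Kaehler_relations_def Let_def by blast
  then show ?thesis
  proof cases
    case 1
    have e: "?e x \<in> carrier F" "?e y \<in> carrier F" "?e (x \<oplus> y) \<in> carrier F"
      using 1 by (simp_all add: free_basis_closed)
    have "K.eqv (\<Psi> a f) (\<Psi> a (?e (x \<oplus> y)) - \<Psi> a (?e x \<oplus>\<^bsub>F\<^esub> ?e y))"
      unfolding 1(1) using e by (intro \<Psi>_diff assms) simp_all
    also have "K.eqv \<dots> (frag_of (a, x \<oplus> y) - (\<Psi> a (?e x) + \<Psi> a (?e y)))"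
      using 1 e by (intro K.eqv_diff \<Psi>_basis \<Psi>_add_right assms) simp_all
    also have "K.eqv \<dots> ((frag_of (a, x) + frag_of (a, y)) - (frag_of (a, x) + frag_of (a, y)))"
      using 1 by (intro K.eqv_diff K.eqv_add \<Psi>_basis symbol_add_right assms)
    finally show ?thesis by simp
  next
    case 2
    have e: "?e x \<in> carrier F" "?e y \<in> carrier F" "?e (x \<otimes> y) \<in> carrier F"
      using 2 by (simp_all add: free_basis_closed)
    have "K.eqv (\<Psi> a f) (\<Psi> a (?e (x \<otimes> y)) - \<Psi> a (x \<odot>\<^bsub>F\<^esub> ?e y \<oplus>\<^bsub>F\<^esub> y \<odot>\<^bsub>F\<^esub> ?e x))"
      unfolding 2(1) using 2(2,3) e by (intro \<Psi>_diff assms) simp_all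
    also have "K.eqv \<dots> (frag_of (a, x \<otimes> y) - (\<Psi> a (x \<odot>\<^bsub>F\<^esub> ?e y) + \<Psi> a (y \<odot>\<^bsub>F\<^esub> ?e x)))"
      using 2(2,3) e by (intro K.eqv_diff \<Psi>_basis \<Psi>_add_right assms) simp_all
    also have "K.eqv \<dots> ((frag_of (a \<otimes> x, y) + frag_of (a \<otimes> y, x)) - (\<Psi> (x \<otimes> a) (?e y) + \<Psi> (y \<otimes> a) (?e x)))"
      using 2(2,3) e
      by (intro K.eqv_diff K.eqv_add K.eqv_sym[OF \<Psi>_smult] symbol_mult_right assms)
    also have "K.eqv \<dots> ((frag_of (a \<otimes> x, y) + frag_of (a \<otimes> y, x)) - (frag_of (x \<otimes> a, y) + frag_of (y \<otimes> a, x)))"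
      using 2(2,3) assms by (intro K.eqv_diff K.eqv_add K.eqv_refl \<Psi>_basis I_l_closed)
    also have "\<dots> = 0"
      using 2(2,3) assms by (simp add: m_comm)
    finally show ?thesis .
  qed
qed

text \<open>The elements killed by \<open>\<Psi> a\<close> for a single \<open>a\<close> are not visibly closed under scalars, since
  \<open>\<Psi> a (c f) = \<Psi> (c a) f\<close>. Those killed for all \<open>a \<in> \<aa>\<close> at once form a submodule, and this
  submodule contains the Kaehler relations.\<close>

lemma \<Psi>_cong:
  assumes "a \<in> \<aa>" "f \<in> carrier F" "g \<in> carrier F" "N +>\<^bsub>F\<^esub> f = N +>\<^bsub>F\<^esub> g"
  shows "K.eqv (\<Psi> a f) (\<Psi> a g)"
proof -
  let ?Z = "{f \<in> carrier F. \<forall>a\<in>\<aa>. K.eqv (\<Psi> a f) 0}"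
  have "submodule ?Z R F"
  proof (rule F.submoduleI_smult)
    fix f g assume *: "f \<in> ?Z" "g \<in> ?Z"
    have "K.eqv (\<Psi> a (f \<oplus>\<^bsub>F\<^esub> g)) 0" if "a \<in> \<aa>" for a
      using K.eqv_trans[OF \<Psi>_add_right K.eqv_add, of a f g 0 0] that * by simp
    then show "f \<oplus>\<^bsub>F\<^esub> g \<in> ?Z"
      using * by simp
  next
    fix c f assume *: "c \<in> carrier R" "f \<in> ?Z"
    have "K.eqv (\<Psi> a (c \<odot>\<^bsub>F\<^esub> f)) 0" if "a \<in> \<aa>" for a
      using K.eqv_trans[OF K.eqv_sym[OF \<Psi>_smult], of a c f 0] that * by (simp add: I_l_closed)
    then show "c \<odot>\<^bsub>F\<^esub> f \<in> ?Z"
      using * by simp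
  qed (auto simp: \<Psi>_zero)
  moreover have "Kaehler_relations R \<subseteq> ?Z"
    using Kaehler_relations_closed \<Psi>_Kaehler_relation by blast
  ultimately have "N \<subseteq> ?Z"
    by (rule F.module_span_least)
  moreover have "f \<ominus>\<^bsub>F\<^esub> g \<in> N"
    using assms F.coset_eq_iff by blast
  ultimately have "K.eqv (\<Psi> a (f \<ominus>\<^bsub>F\<^esub> g)) 0"
    using assms by blast
  then have "K.eqv (\<Psi> a f - \<Psi> a g) 0"
    using assms by (intro K.eqv_trans[OF K.eqv_sym[OF \<Psi>_diff]])
  then show ?thesis
    by (rule K.eqv_iff_diff[THEN iffD2])
qed

definition \<psi> :: "'a \<times> ('a \<Rightarrow> 'a) set \<Rightarrow> 'a \<times> 'a \<Rightarrow>\<^sub>0 int"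
  where "\<psi> = (\<lambda>(a, w). \<Psi> a (SOME f. f \<in> carrier F \<and> w = N +>\<^bsub>F\<^esub> f))"

lemma \<psi>_coset:
  assumes "a \<in> \<aa>" "f \<in> carrier F"
  shows "K.eqv (\<psi> (a, N +>\<^bsub>F\<^esub> f)) (\<Psi> a f)"
proof -
  let ?P = "\<lambda>g. g \<in> carrier F \<and> N +>\<^bsub>F\<^esub> f = N +>\<^bsub>F\<^esub> g"
  have "?P (SOME g. ?P g)"
    using assms by (intro someI[of ?P f]) simp
  then show ?thesis
    unfolding \<psi>_def using assms by (auto intro: \<Psi>_cong)
qed

lemma Kaehler_cosetE:
  assumes "w \<in> carrier \<Omega>"
  obtains f where "f \<in> carrier F" "w = N +>\<^bsub>F\<^esub> f"
  using assms unfolding Kaehler_eq F.carrier_quotient_module by blast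

lemma keys_\<psi>:
  assumes "a \<in> \<aa>" "w \<in> carrier \<Omega>"
  shows "Poly_Mapping.keys (\<psi> (a, w)) \<subseteq> DS_symbols R \<aa>"
proof -
  define f where "f = (SOME f. f \<in> carrier F \<and> w = N +>\<^bsub>F\<^esub> f)"
  have "\<exists>f. f \<in> carrier F \<and> w = N +>\<^bsub>F\<^esub> f"
    using Kaehler_cosetE[OF assms(2)] by blast
  then have "f \<in> carrier F"
    unfolding f_def by (rule someI2_ex) blast
  then have "\<Psi> a f \<in> carrier (free_Abelian_group (DS_symbols R \<aa>))"
    unfolding \<Psi>_def using assms
    by (intro sum_closed_free_Abelian_group) (simp add: DS_symbols_def I_r_closed)
  then show ?thesis
    by (simp add: \<psi>_def f_def)
qed

lemma \<psi>_add_left: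
  assumes "a \<in> \<aa>" "a' \<in> \<aa>" "w \<in> carrier \<Omega>"
  shows "K.eqv (\<psi> (a \<oplus> a', w)) (\<psi> (a, w) + \<psi> (a', w))"
proof -
  obtain f where f: "f \<in> carrier F" "w = N +>\<^bsub>F\<^esub> f"
    using Kaehler_cosetE[OF assms(3)] .
  have "K.eqv (\<psi> (a \<oplus> a', w)) (\<Psi> (a \<oplus> a') f)"
    unfolding f(2) using assms f by (intro \<psi>_coset) simp_all
  also have "K.eqv \<dots> (\<Psi> a f + \<Psi> a' f)"
    by (intro \<Psi>_add_left assms f)
  also have "K.eqv \<dots> (\<psi> (a, w) + \<psi> (a', w))"
    unfolding f(2) by (intro K.eqv_add K.eqv_sym[OF \<psi>_coset] assms f)
  finally show ?thesis .
qed

lemma \<psi>_add_right: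
  assumes "a \<in> \<aa>" "w \<in> carrier \<Omega>" "w' \<in> carrier \<Omega>"
  shows "K.eqv (\<psi> (a, w \<oplus>\<^bsub>\<Omega>\<^esub> w')) (\<psi> (a, w) + \<psi> (a, w'))"
proof -
  obtain f where f: "f \<in> carrier F" "w = N +>\<^bsub>F\<^esub> f"
    using Kaehler_cosetE[OF assms(2)] .
  obtain g where g: "g \<in> carrier F" "w' = N +>\<^bsub>F\<^esub> g"
    using Kaehler_cosetE[OF assms(3)] .
  have "w \<oplus>\<^bsub>\<Omega>\<^esub> w' = N +>\<^bsub>F\<^esub> (f \<oplus>\<^bsub>F\<^esub> g)"
    using f g by (simp add: Kaehler_eq F.quotient_add)
  then have "K.eqv (\<psi> (a, w \<oplus>\<^bsub>\<Omega>\<^esub> w')) (\<Psi> a (f \<oplus>\<^bsub>F\<^esub> g))"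
    using assms f g by (simp add: \<psi>_coset)
  also have "K.eqv \<dots> (\<Psi> a f + \<Psi> a g)"
    by (intro \<Psi>_add_right assms f g)
  also have "K.eqv \<dots> (\<psi> (a, w) + \<psi> (a, w'))"
    unfolding f(2) g(2) by (intro K.eqv_add K.eqv_sym[OF \<psi>_coset] assms f g)
  finally show ?thesis .
qed

lemma \<psi>_smult:
  assumes "a \<in> \<aa>" "c \<in> carrier R" "w \<in> carrier \<Omega>"
  shows "K.eqv (\<psi> (c \<otimes> a, w)) (\<psi> (a, c \<odot>\<^bsub>\<Omega>\<^esub> w))"
proof -
  obtain f where f: "f \<in> carrier F" "w = N +>\<^bsub>F\<^esub> f"
    using Kaehler_cosetE[OF assms(3)] .
  have cf: "c \<odot>\<^bsub>\<Omega>\<^esub> w = N +>\<^bsub>F\<^esub> (c \<odot>\<^bsub>F\<^esub> f)"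
    using f assms by (simp add: Kaehler_eq F.quotient_smult)
  have "K.eqv (\<psi> (c \<otimes> a, w)) (\<Psi> (c \<otimes> a) f)"
    unfolding f(2) using assms f by (intro \<psi>_coset I_l_closed)
  also have "K.eqv \<dots> (\<Psi> a (c \<odot>\<^bsub>F\<^esub> f))"
    by (intro \<Psi>_smult assms f)
  also have "K.eqv \<dots> (\<psi> (a, c \<odot>\<^bsub>\<Omega>\<^esub> w))"
    unfolding cf using assms f by (intro K.eqv_sym[OF \<psi>_coset]) simp_all
  finally show ?thesis .
qed

lemma \<psi>_relation:
  assumes "t \<in> tensor_rels"
  shows "K.eqv (frag_extend \<psi> t) 0"
proof -
  consider
      a a' w where "t = frag_of (a \<oplus> a', w) - frag_of (a, w) - frag_of (a', w)"
        "a \<in> \<aa>" "a' \<in> \<aa>" "w \<in> carrier \<Omega>"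
    | a w w' where "t = frag_of (a, w \<oplus>\<^bsub>\<Omega>\<^esub> w') - frag_of (a, w) - frag_of (a, w')"
        "a \<in> \<aa>" "w \<in> carrier \<Omega>" "w' \<in> carrier \<Omega>"
    | c a w where "t = frag_of (c \<otimes> a, w) - frag_of (a, c \<odot>\<^bsub>\<Omega>\<^esub> w)"
        "a \<in> \<aa>" "c \<in> carrier R" "w \<in> carrier \<Omega>"
    using assms unfolding tensor_relations_def ideal_module_simps by blast
  then show ?thesis
  proof cases
    case 1
    then show ?thesis
      using \<psi>_add_left[OF 1(2-4)]
      by (simp add: frag_extend_diff frag_extend_add diff_diff_eq flip: K.eqv_iff_diff)
  next
    case 2
    then show ?thesis
      using \<psi>_add_right[OF 2(2-4)]
      by (simp add: frag_extend_diff frag_extend_add diff_diff_eq flip: K.eqv_iff_diff)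
  next
    case 3
    then show ?thesis
      using \<psi>_smult[OF 3(2-4)] by (simp add: frag_extend_diff flip: K.eqv_iff_diff)
  qed
qed

subsection \<open>The isomorphism\<close>

lemma \<psi>_d:
  assumes "a \<in> \<aa>" "b \<in> carrier R"
  shows "K.eqv (\<psi> (a, d b)) (frag_of (a, b))"
  unfolding d_def
  using K.eqv_trans[OF \<psi>_coset[OF assms(1)] \<Psi>_basis[OF assms]] assms
  by (simp add: free_basis_closed)

lemma \<psi>_\<phi>:
  assumes "(a, b) \<in> DS_symbols R \<aa>"
  shows "K.eqv (frag_extend \<psi> (\<phi> (a, b))) (frag_of (a, b))"
proof (cases "a \<in> \<aa>")
  case True
  then show ?thesis
    using assms \<psi>_d[of a b] by (auto simp: \<phi>_left DS_symbols_def)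
next
  case False
  then have *: "a \<in> carrier R" "b \<in> \<aa>"
    using assms by (auto simp: DS_symbols_def)
  have "K.eqv (- \<psi> (b, d a)) (- frag_of (b, a))"
    by (intro K.eqv_minus \<psi>_d *)
  also have "K.eqv \<dots> (frag_of (a, b))"
    by (rule K.eqv_sym[OF symbol_skew[OF assms]])
  finally show ?thesis
    using False by (simp add: \<phi>_def frag_extend_minus)
qed

lemma \<phi>_eqv: "K.eqv u v \<Longrightarrow> T.eqv (frag_extend \<phi> u) (frag_extend \<phi> v)"
  by (rule frag_extend_eqv[OF presentation_K2 presentation_tensor \<phi>_relation])

text \<open>Quantifying over all \<open>a \<in> \<aa>\<close> again turns the elements \<open>f\<close> that satisfy the claim into a
  submodule; it contains the basis, where the claim reads \<open>\<phi> \<langle>a, s\<rangle> = a \<otimes> d s\<close>.\<close>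

lemma \<phi>_\<Psi>:
  assumes "a \<in> \<aa>" "f \<in> carrier F"
  shows "T.eqv (frag_extend \<phi> (\<Psi> a f)) (frag_of (a, N +>\<^bsub>F\<^esub> f))"
proof -
  let ?Z = "{f \<in> carrier F. \<forall>a\<in>\<aa>. T.eqv (frag_extend \<phi> (\<Psi> a f)) (frag_of (a, N +>\<^bsub>F\<^esub> f))}"
  have coset_closed: "N +>\<^bsub>F\<^esub> f \<in> carrier \<Omega>" if "f \<in> carrier F" for f
    unfolding Kaehler_eq using that by (rule F.quotient_closed)
  have "submodule ?Z R F"
  proof (rule F.submoduleI_smult)
    have "T.eqv (frag_extend \<phi> (\<Psi> a \<zero>\<^bsub>F\<^esub>)) (frag_of (a, N +>\<^bsub>F\<^esub> \<zero>\<^bsub>F\<^esub>))" if "a \<in> \<aa>" for a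
      using T.eqv_sym[OF tensor_zero_right[OF that]]
      by (simp only: \<Psi>_zero frag_extend_0 Kaehler_eq F.quotient_zero)
    then show "\<zero>\<^bsub>F\<^esub> \<in> ?Z"
      by simp
  next
    fix f g assume *: "f \<in> ?Z" "g \<in> ?Z"
    have "T.eqv (frag_extend \<phi> (\<Psi> a (f \<oplus>\<^bsub>F\<^esub> g))) (frag_of (a, N +>\<^bsub>F\<^esub> (f \<oplus>\<^bsub>F\<^esub> g)))"
      if a: "a \<in> \<aa>" for a
    proof -
      have "T.eqv (frag_extend \<phi> (\<Psi> a (f \<oplus>\<^bsub>F\<^esub> g))) (frag_extend \<phi> (\<Psi> a f + \<Psi> a g))"
        using * a by (intro \<phi>_eqv \<Psi>_add_right) simp_all
      also have "\<dots> = frag_extend \<phi> (\<Psi> a f) + frag_extend \<phi> (\<Psi> a g)"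
        by (rule frag_extend_add)
      also have "T.eqv \<dots> (frag_of (a, N +>\<^bsub>F\<^esub> f) + frag_of (a, N +>\<^bsub>F\<^esub> g))"
        using * a by (intro T.eqv_add) simp_all
      also have "T.eqv \<dots> (frag_of (a, (N +>\<^bsub>F\<^esub> f) \<oplus>\<^bsub>\<Omega>\<^esub> (N +>\<^bsub>F\<^esub> g)))"
        using * a by (intro T.eqv_sym[OF tensor_add_right] coset_closed) simp_all
      also have "(N +>\<^bsub>F\<^esub> f) \<oplus>\<^bsub>\<Omega>\<^esub> (N +>\<^bsub>F\<^esub> g) = N +>\<^bsub>F\<^esub> (f \<oplus>\<^bsub>F\<^esub> g)"
        unfolding Kaehler_eq using * by (intro F.quotient_add) simp_all
      finally show ?thesis .
    qed
    then show "f \<oplus>\<^bsub>F\<^esub> g \<in> ?Z"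
      using * by simp
  next
    fix c f assume *: "c \<in> carrier R" "f \<in> ?Z"
    have "T.eqv (frag_extend \<phi> (\<Psi> a (c \<odot>\<^bsub>F\<^esub> f))) (frag_of (a, N +>\<^bsub>F\<^esub> (c \<odot>\<^bsub>F\<^esub> f)))"
      if a: "a \<in> \<aa>" for a
    proof -
      have "T.eqv (frag_extend \<phi> (\<Psi> a (c \<odot>\<^bsub>F\<^esub> f))) (frag_extend \<phi> (\<Psi> (c \<otimes> a) f))"
        using * a by (intro \<phi>_eqv K.eqv_sym[OF \<Psi>_smult]) simp_all
      also have "T.eqv \<dots> (frag_of (c \<otimes> a, N +>\<^bsub>F\<^esub> f))"
        using * a by (simp add: I_l_closed)
      also have "T.eqv \<dots> (frag_of (a, c \<odot>\<^bsub>\<Omega>\<^esub> (N +>\<^bsub>F\<^esub> f)))"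
        using * a by (intro tensor_smult coset_closed) simp_all
      also have "c \<odot>\<^bsub>\<Omega>\<^esub> (N +>\<^bsub>F\<^esub> f) = N +>\<^bsub>F\<^esub> (c \<odot>\<^bsub>F\<^esub> f)"
        unfolding Kaehler_eq using * by (intro F.quotient_smult) simp_all
      finally show ?thesis .
    qed
    then show "c \<odot>\<^bsub>F\<^esub> f \<in> ?Z"
      using * by simp
  qed simp
  moreover have "free_basis R (carrier R) s \<in> ?Z" if s: "s \<in> carrier R" for s
  proof -
    have "T.eqv (frag_extend \<phi> (\<Psi> a (free_basis R (carrier R) s))) (frag_of (a, d s))"
      if "a \<in> \<aa>" for a
      using \<phi>_eqv[OF \<Psi>_basis[OF that s]] that by (simp add: \<phi>_left)
    then show ?thesis
      using s by (simp add: free_basis_closed d_def)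
  qed
  ultimately have "f \<in> ?Z"
    using assms(2) by (rule free_module_eq_submodule)
  then show ?thesis
    using assms(1) by blast
qed

lemma \<phi>_\<psi>:
  assumes "a \<in> \<aa>" "w \<in> carrier \<Omega>"
  shows "T.eqv (frag_extend \<phi> (\<psi> (a, w))) (frag_of (a, w))"
proof -
  obtain f where f: "f \<in> carrier F" "w = N +>\<^bsub>F\<^esub> f"
    using Kaehler_cosetE[OF assms(2)] .
  show ?thesis
    unfolding f(2) by (rule T.eqv_trans[OF \<phi>_eqv[OF \<psi>_coset] \<phi>_\<Psi>]) (fact assms f)+
qed

theorem K2_rel_iso_tensor_Kaehler: "K2_rel R \<aa> \<cong> tensor_group R (ideal_module R \<aa>) \<Omega>"
  unfolding K2_rel_def tensor_group_def ideal_module_simps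
proof (rule presented_ab_group_iso[where f = \<phi> and g = \<psi>])
  show "presentation (DS_symbols R \<aa>) (DS_relations R \<aa>)" "presentation tensor_gens tensor_rels"
    by (fact presentation_K2 presentation_tensor)+
  show "Poly_Mapping.keys (\<phi> s) \<subseteq> tensor_gens"
    "K.eqv (frag_extend \<psi> (\<phi> s)) (frag_of s)" if "s \<in> DS_symbols R \<aa>" for s
    using that keys_\<phi> \<psi>_\<phi> by (metis surj_pair)+
  show "Poly_Mapping.keys (\<psi> s) \<subseteq> DS_symbols R \<aa>"
    "T.eqv (frag_extend \<phi> (\<psi> s)) (frag_of s)" if "s \<in> tensor_gens" for s
    using that keys_\<psi> \<phi>_\<psi> by (metis mem_Times_iff surj_pair fst_conv snd_conv)+
qed (fact \<phi>_relation \<psi>_relation)+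

end

section \<open>The quotient by the given ideal\<close>

text \<open>Since \<open>r > 1\<close>, the product \<open>p = b\<^sub>1 \<cdots> b\<^sub>r\<close> splits as \<open>b\<^sub>1 q\<close> where \<open>q\<close> still contains the factor
  \<open>b\<^sub>2\<close>. Modulo \<open>I\<close>, both \<open>b\<^sub>1\<close> and \<open>q\<close> annihilate \<open>J\<close>, and every element of \<open>J\<close> is of the form
  \<open>x p = b\<^sub>1 (x q)\<close>; this is the required factorisation in \<open>J/I\<close>.\<close>

theorem theorem2p3:
  fixes A :: "('a, 'm) ring_scheme" (structure)
    and I J :: "'a set" and r :: nat and b :: "nat \<Rightarrow> 'a"
  assumes "cring A"
    and "ideal I A"
    and "r > 1"
    and "\<And>i. i \<in> {1..r} \<Longrightarrow> b i \<in> carrier A"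
    and "J = PIdl (\<Otimes>i\<in>{1..r}. b i) <+> I"
    and "\<And>i. i \<in> {1..r} \<Longrightarrow> (\<lambda>x. b i \<otimes> x) ` J \<subseteq> I"
  shows "K2_rel (A Quot I) (quotient_ideal A J I) \<cong>
    tensor_group (A Quot I) (ideal_module (A Quot I) (quotient_ideal A J I)) (Kaehler (A Quot I))"
proof -
  interpret cring A by fact
  interpret I: ideal I A by fact
  let ?R = "A Quot I" and ?\<pi> = "(+>) I"
  let ?p = "\<Otimes>i\<in>{1..r}. b i" and ?q = "\<Otimes>i\<in>{2..r}. b i" and ?q' = "\<Otimes>i\<in>{3..r}. b i"
  interpret \<pi>: ring_hom_cring A ?R ?\<pi>
    by (rule I.rcos_ring_hom_cring) fact
  have b: "b 1 \<in> carrier A" "b 2 \<in> carrier A" "b \<in> {2..r} \<rightarrow> carrier A" "b \<in> {3..r} \<rightarrow> carrier A"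
    using assms(3,4) by auto
  then have q: "?q \<in> carrier A" "?q' \<in> carrier A"
    by simp_all
  have "{1..r} = insert 1 {2..r}" "{2..r} = insert 2 {3..r}"
    using assms(3) by auto
  then have p_eq: "?p = b 1 \<otimes> ?q" and q_eq: "?q = b 2 \<otimes> ?q'"
    using b by simp_all
  then have p: "?p \<in> carrier A"
    using b q by simp
  have J: "ideal J A"
    unfolding assms(5) by (intro add_ideals cgenideal_ideal p I.is_ideal)
  then have J_carrier: "j \<in> carrier A" if "j \<in> J" for j
    using that ideal.Icarr by metis
  have bJ: "b 1 \<otimes> j \<in> I" "b 2 \<otimes> j \<in> I" if "j \<in> J" for j
    using assms(3) assms(6)[of 1] assms(6)[of 2] that by (simp_all add: image_subset_iff)
  have qJ: "?q \<otimes> j \<in> I" if "j \<in> J" for j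
  proof -
    have "?q \<otimes> j = ?q' \<otimes> (b 2 \<otimes> j)"
      unfolding q_eq using b q J_carrier[OF that] by (simp add: m_ac)
    then show ?thesis
      using I.I_l_closed[OF bJ(2)[OF that] q(2)] by simp
  qed
  have \<pi>_zero: "?\<pi> j = \<zero>\<^bsub>?R\<^esub>" if "j \<in> I" for j
    using I.a_rcos_const[OF that] unfolding FactRing_def ring.simps .
  have \<aa>: "ideal (?\<pi> ` J) ?R"
    by (rule ring_ideal_imp_quot_ideal[OF I.is_ideal J])
  interpret factored_annihilated_ideal ?R "?\<pi> ` J"
  proof (intro factored_annihilated_ideal.intro kaehler_differentials.intro
      factored_annihilated_ideal_axioms.intro)
    show "cring ?R" ..
    show "ideal (?\<pi> ` J) ?R" by (rule \<aa>)
    fix w assume "w \<in> ?\<pi> ` J"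
    then obtain x k where x: "x \<in> carrier A" and k: "k \<in> I" and w: "w = ?\<pi> (x \<otimes> ?p \<oplus> k)"
      unfolding assms(5) by (auto simp: cgenideal_def set_add_def')
    have "w = ?\<pi> (x \<otimes> ?p)"
      using w x k p I.a_Hcarr[OF k] by (simp add: \<pi>_zero)
    also have "x \<otimes> ?p = b 1 \<otimes> (x \<otimes> ?q)"
      unfolding p_eq using x b(1) q(1) by (rule m_lcomm)
    finally have "w = ?\<pi> (b 1 \<otimes> (x \<otimes> ?q))" .
    then have "w = ?\<pi> (b 1) \<otimes>\<^bsub>?R\<^esub> ?\<pi> (x \<otimes> ?q)"
      using x b q by simp
    moreover have "\<forall>a\<in>?\<pi> ` J. ?\<pi> (b 1) \<otimes>\<^bsub>?R\<^esub> a = \<zero>\<^bsub>?R\<^esub>"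
    proof
      fix a assume "a \<in> ?\<pi> ` J"
      then obtain j where j: "j \<in> J" "a = ?\<pi> j" by blast
      then have "?\<pi> (b 1) \<otimes>\<^bsub>?R\<^esub> a = ?\<pi> (b 1 \<otimes> j)"
        using b J_carrier by simp
      then show "?\<pi> (b 1) \<otimes>\<^bsub>?R\<^esub> a = \<zero>\<^bsub>?R\<^esub>"
        using \<pi>_zero[OF bJ(1)[OF j(1)]] by simp
    qed
    moreover have "\<forall>a\<in>?\<pi> ` J. ?\<pi> (x \<otimes> ?q) \<otimes>\<^bsub>?R\<^esub> a = \<zero>\<^bsub>?R\<^esub>"
    proof
      fix a assume "a \<in> ?\<pi> ` J"
      then obtain j where j: "j \<in> J" "a = ?\<pi> j" by blast
      then have "?\<pi> (x \<otimes> ?q) \<otimes>\<^bsub>?R\<^esub> a = ?\<pi> (x \<otimes> (?q \<otimes> j))"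
        using x q J_carrier by (simp add: \<pi>.S.m_assoc)
      then show "?\<pi> (x \<otimes> ?q) \<otimes>\<^bsub>?R\<^esub> a = \<zero>\<^bsub>?R\<^esub>"
        using \<pi>_zero[OF I.I_l_closed[OF qJ[OF j(1)] x]] by simp
    qed
    moreover have "?\<pi> (b 1) \<in> carrier ?R" "?\<pi> (x \<otimes> ?q) \<in> carrier ?R"
      using x b q by simp_all
    ultimately show "\<exists>y\<in>carrier ?R. \<exists>z\<in>carrier ?R. w = y \<otimes>\<^bsub>?R\<^esub> z \<and>
        (\<forall>a\<in>?\<pi> ` J. y \<otimes>\<^bsub>?R\<^esub> a = \<zero>\<^bsub>?R\<^esub>) \<and> (\<forall>a\<in>?\<pi> ` J. z \<otimes>\<^bsub>?R\<^esub> a = \<zero>\<^bsub>?R\<^esub>)"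
      by blast
  qed
  show ?thesis
    unfolding quotient_ideal_def by (rule K2_rel_iso_tensor_Kaehler)
qed

end
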